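(* For every integer $k\geq 1$, the space $B\big(\bigvee^k S^1,2\big)$ is homotopy equivalent to a wedge of circles $\bigvee^{N}S^1$ with $N=\frac{3}{2}k(k-1)+1$.
   Context: $\bigvee^k S^1$ denotes the wedge (bouquet) of $k$ circles. For a space $X$, $B(X,2)$ is the configuration space of unordered pairs of distinct points of $X$: the quotient of $\{(x,y)\in X^2: x\neq y\}$ by the swap action of $\mathfrak S_2$. *)

theory Defs
  imports "HOL-Analysis.Analysis"
begin

text \<open>The quotient topology on the set of \<open>R\<close>-classes, i.e. the final topology for
  \<open>x \<mapsto> R `` {x}\<close>; meaningful when \<open>R\<close> is an equivalence relation on \<open>topspace X\<close>.\<close>

definition quotient_topology :: "'a topology \<Rightarrow> ('a \<times> 'a) set \<Rightarrow> 'a set topology" where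
  "quotient_topology X R =
     topology (\<lambda>U. U \<subseteq> topspace X // R \<and> openin X {x \<in> topspace X. R `` {x} \<in> U})"

lemma openin_quotient_topology:
  "openin (quotient_topology X R) U \<longleftrightarrow>
     U \<subseteq> topspace X // R \<and> openin X {x \<in> topspace X. R `` {x} \<in> U}"
proof -
  have "istopology (\<lambda>U. U \<subseteq> topspace X // R \<and> openin X {x \<in> topspace X. R `` {x} \<in> U})"
    (is "istopology ?P")
    unfolding istopology_def
  proof (intro conjI allI impI)
    fix S T assume "?P S" "?P T"
    moreover have "{x \<in> topspace X. R `` {x} \<in> S \<inter> T} =
        {x \<in> topspace X. R `` {x} \<in> S} \<inter> {x \<in> topspace X. R `` {x} \<in> T}" by auto
    ultimately show "S \<inter> T \<subseteq> topspace X // R" "openin X {x \<in> topspace X. R `` {x} \<in> S \<inter> T}"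
      by (auto simp only: openin_Int)
  next
    fix K assume K: "\<forall>S\<in>K. ?P S"
    then show "\<Union>K \<subseteq> topspace X // R" by blast
    have "{x \<in> topspace X. R `` {x} \<in> \<Union>K} =
        (\<Union>S\<in>K. {x \<in> topspace X. R `` {x} \<in> S})" by auto
    with K show "openin X {x \<in> topspace X. R `` {x} \<in> \<Union>K}"
      by (metis (no_types, lifting) openin_clauses(3) imageE)
  qed
  then show ?thesis
    by (simp add: quotient_topology_def topology_inverse')
qed

lemma topspace_quotient_topology: "topspace (quotient_topology X R) = topspace X // R"
proof -
  have "{x \<in> topspace X. R `` {x} \<in> topspace X // R} = topspace X"
    by (auto intro: quotientI)
  then have "openin (quotient_topology X R) (topspace X // R)"
    by (simp add: openin_quotient_topology)
  then show ?thesis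
    by (meson openin_quotient_topology openin_subset openin_topspace subset_antisym)
qed

lemma quotient_map_quotient_topology:
  "quotient_map X (quotient_topology X R) (\<lambda>x. R `` {x})"
  unfolding quotient_map_def topspace_quotient_topology
  by (auto simp: openin_quotient_topology quotient_def)

definition circles :: "nat \<Rightarrow> (nat \<times> complex) topology" where
  "circles k = sum_topology (\<lambda>_. top_of_set (sphere 0 1)) {..<k}"

text \<open>All the base points \<open>(i, 1)\<close> are identified. For \<open>k = 0\<close> this yields the empty
  space rather than a point.\<close>

definition bouquet_rel :: "nat \<Rightarrow> ((nat \<times> complex) \<times> (nat \<times> complex)) set" where
  "bouquet_rel k = {(a, b). a \<in> topspace (circles k) \<and> b \<in> topspace (circles k) \<and>
                            (a = b \<or> snd a = 1 \<and> snd b = 1)}"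

lemma equiv_bouquet_rel: "equiv (topspace (circles k)) (bouquet_rel k)"
  by (intro equivI refl_onI symI transI) (auto simp: bouquet_rel_def)

definition bouquet :: "nat \<Rightarrow> (nat \<times> complex) set topology" where
  "bouquet k = quotient_topology (circles k) (bouquet_rel k)"

definition ordered_conf2 :: "'a topology \<Rightarrow> ('a \<times> 'a) topology" where
  "ordered_conf2 X = subtopology (prod_topology X X) {(x, y). x \<noteq> y}"

definition swap_rel :: "'a topology \<Rightarrow> (('a \<times> 'a) \<times> ('a \<times> 'a)) set" where
  "swap_rel X = {(p, q). p \<in> topspace (ordered_conf2 X) \<and> q \<in> topspace (ordered_conf2 X) \<and>
                         (q = p \<or> q = prod.swap p)}"

lemma equiv_swap_rel: "equiv (topspace (ordered_conf2 X)) (swap_rel X)"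
  by (intro equivI refl_onI symI transI) (auto simp: swap_rel_def)

definition unordered_conf2 :: "'a topology \<Rightarrow> ('a \<times> 'a) set topology" where
  "unordered_conf2 X = quotient_topology (ordered_conf2 X) (swap_rel X)"

end

(* Order the two points of a pair by their distance to the base point. The ratio rho of the
   distances maps the configuration space onto a finite graph: rho = 0 (the inner point is the base
   point) gives one vertex for each circle containing the outer point, rho = 1 (equal distances)
   gives one vertex for each unordered pair {i, j} of possibly equal circles, and a pair with
   0 < rho < 1 lies on the edge given by the circle of the outer point, that of the inner point and
   the half of the latter containing the inner point. The fibres are contracted by moving the outer
   point with rho fixed, so this map is a homotopy equivalence. The graph is connected with 2k^2
   edges and k + k(k + 1)/2 vertices, and contracting non-loop edges one by one turns a connected
   graph with E edges and V vertices into a bouquet of E - V + 1 circles. *)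

theory Submission
  imports Defs
begin

section \<open>Maps and homotopies on sums and quotients\<close>

text \<open>The obstacle is a pair on a single circle. Sending the outer point to the middle of its
  circle may make it meet the inner point, and at equal distances the roles are interchangeable, so
  the motion must look the same whichever point is called outer. The ratio is defined because the
  outer one of two distinct points is never the base point. Keeping it fixed drags the inner point
  along and excludes collisions while \<rho> < 1; for \<rho> = 1 the points of a single circle stay
  on opposite halves. The configuration space, the graphs and the bouquets are all presented as
  quotients of disjoint sums of subsets of the plane or the line. Maps and homotopies are formulas
  on the pieces and descend when they agree on identified points. For the bouquets compactness
  yields such a presentation; the configuration space is not compact, so its presentation by sectors
  is derived from a closed map on a compact space and a finite closed cover.\<close>

lemma continuous_map_prod_sum_topology:
  assumes "\<And>i. i \<in> I \<Longrightarrow> continuous_map (prod_topology Y (X i)) Z (\<lambda>(y, x). f (y, (i, x)))"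
  shows "continuous_map (prod_topology Y (sum_topology X I)) Z f"
  unfolding continuous_map_def
proof (intro conjI allI impI)
  show "f \<in> topspace (prod_topology Y (sum_topology X I)) \<rightarrow> topspace Z"
  proof
    fix z assume "z \<in> topspace (prod_topology Y (sum_topology X I))"
    then obtain y i x where "z = (y, (i, x))" "i \<in> I" "x \<in> topspace (X i)" "y \<in> topspace Y"
      by auto
    then show "f z \<in> topspace Z"
      using continuous_map_funspace[OF assms[of i]] by (auto simp: Pi_iff)
  qed
next
  fix U assume U: "openin Z U"
  show "openin (prod_topology Y (sum_topology X I))
          {x \<in> topspace (prod_topology Y (sum_topology X I)). f x \<in> U}"
    unfolding openin_prod_topology_alt
  proof (intro allI impI)
    fix y z assume "(y, z) \<in> {x \<in> topspace (prod_topology Y (sum_topology X I)). f x \<in> U}"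
    then obtain i x where z: "z = (i, x)" "i \<in> I" "x \<in> topspace (X i)" "y \<in> topspace Y" "f (y, (i, x)) \<in> U"
      by auto
    have "openin (prod_topology Y (X i)) {p \<in> topspace (prod_topology Y (X i)). (\<lambda>(y, x). f (y, (i, x))) p \<in> U}"
      by (rule openin_continuous_map_preimage[OF assms[OF z(2)] U])
    moreover have "(y, x) \<in> {p \<in> topspace (prod_topology Y (X i)). (\<lambda>(y, x). f (y, (i, x))) p \<in> U}"
      using z by simp
    ultimately obtain V W where VW: "openin Y V" "openin (X i) W" "y \<in> V" "x \<in> W"
        "V \<times> W \<subseteq> {p \<in> topspace (prod_topology Y (X i)). (\<lambda>(y, x). f (y, (i, x))) p \<in> U}"
      unfolding openin_prod_topology_alt by (elim allE impE) auto
    have "openin (sum_topology X I) (Pair i ` W)"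
      using open_map_component_injection[where X = X, OF z(2)] VW(2) by (simp add: open_map_def)
    moreover have "V \<times> Pair i ` W \<subseteq> {x \<in> topspace (prod_topology Y (sum_topology X I)). f x \<in> U}"
      using VW(5) z(2) by (auto simp: subset_iff)
    ultimately show "\<exists>V W. openin Y V \<and> openin (sum_topology X I) W \<and> y \<in> V \<and> z \<in> W \<and>
        V \<times> W \<subseteq> {x \<in> topspace (prod_topology Y (sum_topology X I)). f x \<in> U}"
      using VW z(1) by blast
  qed
qed

lemma continuous_map_from_sum_topology:
  assumes "\<And>i. i \<in> I \<Longrightarrow> continuous_map (X i) Z (\<lambda>x. f (i, x))"
  shows "continuous_map (sum_topology X I) Z f"
  unfolding continuous_map_def
proof (intro conjI allI impI)
  show "f \<in> topspace (sum_topology X I) \<rightarrow> topspace Z"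
    using continuous_map_funspace[OF assms] by (fastforce simp: Pi_iff)
next
  fix U assume U: "openin Z U"
  have "openin (X i) {x. (i, x) \<in> {x \<in> topspace (sum_topology X I). f x \<in> U}}" if "i \<in> I" for i
  proof -
    have "{x. (i, x) \<in> {x \<in> topspace (sum_topology X I). f x \<in> U}} = {x \<in> topspace (X i). f (i, x) \<in> U}"
      using that by auto
    then show ?thesis
      using openin_continuous_map_preimage[OF assms[OF that] U] by simp
  qed
  then show "openin (sum_topology X I) {x \<in> topspace (sum_topology X I). f x \<in> U}"
    unfolding openin_sum_topology by auto
qed

text \<open>The unit interval is locally compact and Hausdorff, so its product with a quotient map
  is again a quotient map; hence a homotopy written on representatives descends to
  \<open>X\<close>.\<close>

lemma quotient_map_homotopy:
  assumes p: "quotient_map A X p"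
    and cont: "continuous_map (prod_topology (top_of_set {0..1::real}) A) Z H"
    and compat: "\<And>t a a'. \<lbrakk>t \<in> {0..1}; a \<in> topspace A; a' \<in> topspace A; p a = p a'\<rbrakk> \<Longrightarrow> H (t, a) = H (t, a')"
  obtains h where "continuous_map (prod_topology (top_of_set {0..1}) X) Z h"
    "\<And>t a. t \<in> {0..1} \<Longrightarrow> a \<in> topspace A \<Longrightarrow> h (t, p a) = H (t, a)"
proof -
  have Q: "quotient_map (prod_topology (top_of_set {0..1::real}) A) (prod_topology (top_of_set {0..1}) X)
      (\<lambda>(t, a). (t, p a))"
  proof (rule quotient_map_prod_right[OF _ _ p])
    show "locally_compact_space (top_of_set {0..1::real})"
      by (simp add: compact_imp_locally_compact_space compact_space_subtopology)
    show "Hausdorff_space (top_of_set {0..1::real}) \<or> regular_space (top_of_set {0..1::real})"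
      by (simp add: Hausdorff_space_subtopology)
  qed
  have c: "H x = H y" if "x \<in> topspace (prod_topology (top_of_set {0..1::real}) A)"
    "y \<in> topspace (prod_topology (top_of_set {0..1::real}) A)"
    "(\<lambda>(t, a). (t, p a)) x = (\<lambda>(t, a). (t, p a)) y" for x y
  proof -
    obtain t a t' a' where "x = (t, a)" "y = (t', a')"
      by fastforce
    with that show ?thesis
      using compat[of t a a'] by simp
  qed
  show ?thesis
  proof (rule quotient_map_lift_exists[OF Q cont])
    show "H x = H y" if "x \<in> topspace (prod_topology (top_of_set {0..1::real}) A)"
      "y \<in> topspace (prod_topology (top_of_set {0..1::real}) A)"
      "(case x of (t, a) \<Rightarrow> (t, p a)) = (case y of (t, a) \<Rightarrow> (t, p a))" for x y
      using that by (rule c)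
  next
    fix h
    assume h: "continuous_map (prod_topology (top_of_set {0..1}) X) Z h"
      "\<And>x. x \<in> topspace (prod_topology (top_of_set {0..1}) A) \<Longrightarrow> h (case x of (t, a) \<Rightarrow> (t, p a)) = H x"
    have "h (t, p a) = H (t, a)" if "t \<in> {0..1}" "a \<in> topspace A" for t a
      using h(2)[of "(t, a)"] that by simp
    with h(1) that show thesis
      by (metis (no_types, lifting))
  qed
qed

text \<open>The four maps are defined on representatives but take values in the quotients, so none
  of them has to lift to \<open>A\<close> or \<open>C\<close>. \<open>H1\<close> and
  \<open>K1\<close> range over every representative of the intermediate point, since
  \<open>f a\<close> and \<open>g c\<close> come without chosen preimages; they say that the
  homotopies end at the two composites.\<close>

lemma homotopy_equivalent_space_quotients:
  assumes p: "quotient_map A X p" and q: "quotient_map C Y q"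
    and f: "continuous_map A Y f" and g: "continuous_map C X g"
    and H: "continuous_map (prod_topology (top_of_set {0..1::real}) A) X H"
    and K: "continuous_map (prod_topology (top_of_set {0..1::real}) C) Y K"
    and f_compat: "\<And>a a'. \<lbrakk>a \<in> topspace A; a' \<in> topspace A; p a = p a'\<rbrakk> \<Longrightarrow> f a = f a'"
    and g_compat: "\<And>c c'. \<lbrakk>c \<in> topspace C; c' \<in> topspace C; q c = q c'\<rbrakk> \<Longrightarrow> g c = g c'"
    and H_compat: "\<And>t a a'. \<lbrakk>t \<in> {0..1}; a \<in> topspace A; a' \<in> topspace A; p a = p a'\<rbrakk>
                     \<Longrightarrow> H (t, a) = H (t, a')"
    and K_compat: "\<And>t c c'. \<lbrakk>t \<in> {0..1}; c \<in> topspace C; c' \<in> topspace C; q c = q c'\<rbrakk>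
                     \<Longrightarrow> K (t, c) = K (t, c')"
    and H0: "\<And>a. a \<in> topspace A \<Longrightarrow> H (0, a) = p a"
    and K0: "\<And>c. c \<in> topspace C \<Longrightarrow> K (0, c) = q c"
    and H1: "\<And>a c. \<lbrakk>a \<in> topspace A; c \<in> topspace C; f a = q c\<rbrakk> \<Longrightarrow> H (1, a) = g c"
    and K1: "\<And>a c. \<lbrakk>a \<in> topspace A; c \<in> topspace C; g c = p a\<rbrakk> \<Longrightarrow> K (1, c) = f a"
  shows "X homotopy_equivalent_space Y"
proof -
  obtain F where F: "continuous_map X Y F" "F ` topspace X = f ` topspace A"
      "\<And>a. a \<in> topspace A \<Longrightarrow> F (p a) = f a"
    by (rule quotient_map_lift_exists[OF p f]) ((rule f_compat; assumption) | (rule that; assumption))+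
  obtain G where G: "continuous_map Y X G" "G ` topspace Y = g ` topspace C"
      "\<And>c. c \<in> topspace C \<Longrightarrow> G (q c) = g c"
    by (rule quotient_map_lift_exists[OF q g]) ((rule g_compat; assumption) | (rule that; assumption))+
  obtain h where h: "continuous_map (prod_topology (top_of_set {0..1}) X) X h"
    "\<And>t a. t \<in> {0..1} \<Longrightarrow> a \<in> topspace A \<Longrightarrow> h (t, p a) = H (t, a)"
    by (rule quotient_map_homotopy[OF p H]) ((rule H_compat; assumption) | (rule that; assumption))+
  obtain k where k: "continuous_map (prod_topology (top_of_set {0..1}) Y) Y k"
    "\<And>t c. t \<in> {0..1} \<Longrightarrow> c \<in> topspace C \<Longrightarrow> k (t, q c) = K (t, c)"
    by (rule quotient_map_homotopy[OF q K]) ((rule K_compat; assumption) | (rule that; assumption))+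
  have X: "\<exists>a\<in>topspace A. x = p a" if "x \<in> topspace X" for x
    using p that by (auto simp: quotient_map_def)
  have Y: "\<exists>c\<in>topspace C. y = q c" if "y \<in> topspace Y" for y
    using q that by (auto simp: quotient_map_def)
  have f_top: "f a \<in> topspace Y" if "a \<in> topspace A" for a
    using f that by (auto simp: continuous_map_def)
  have g_top: "g c \<in> topspace X" if "c \<in> topspace C" for c
    using g that by (auto simp: continuous_map_def)
  have hX: "h (0, x) = x" "h (1, x) = G (F x)" if x: "x \<in> topspace X" for x
  proof -
    obtain a where a: "a \<in> topspace A" "x = p a"
      using X[OF x] by blast
    obtain c where c: "c \<in> topspace C" "f a = q c"
      using Y[OF f_top[OF a(1)]] by blast
    show "h (0, x) = x" "h (1, x) = G (F x)"
      using a c F(3)[OF a(1)] G(3)[OF c(1)] h(2)[OF _ a(1)] H0[OF a(1)] H1[OF a(1) c] by simp_all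
  qed
  have kY: "k (0, y) = y" "k (1, y) = F (G y)" if y: "y \<in> topspace Y" for y
  proof -
    obtain c where c: "c \<in> topspace C" "y = q c"
      using Y[OF y] by blast
    obtain a where a: "a \<in> topspace A" "g c = p a"
      using X[OF g_top[OF c(1)]] by blast
    show "k (0, y) = y" "k (1, y) = F (G y)"
      using a c F(3)[OF a(1)] G(3)[OF c(1)] k(2)[OF _ c(1)] K0[OF c(1)] K1[OF a(1) c(1) a(2)] by simp_all
  qed
  have GF: "homotopic_with (\<lambda>x. True) X X id (G \<circ> F)"
    by (subst homotopic_with, simp, intro exI[of _ h]) (simp add: h(1) hX)
  have FG: "homotopic_with (\<lambda>x. True) Y Y id (F \<circ> G)"
    by (subst homotopic_with, simp, intro exI[of _ k]) (simp add: k(1) kY)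
  show ?thesis
    unfolding homotopy_equivalent_space_def
    by (intro exI[of _ F] exI[of _ G] conjI F(1) G(1) homotopic_with_symD[OF GF] homotopic_with_symD[OF FG])
qed

lemma prod_top_of_set: "prod_topology (top_of_set S) (top_of_set T) = top_of_set (S \<times> T)"
  by (simp add: prod_topology_subtopology_eu)

section \<open>Finite graphs\<close>

definition edge_space :: "'e set \<Rightarrow> ('e \<times> real) topology" where
  "edge_space E = sum_topology (\<lambda>_. top_of_set {0..1}) E"

text \<open>The end vertices of an edge \<open>e\<close> are \<open>d (e, 0)\<close> and \<open>d (e, 1)\<close>; all other values of \<open>d\<close>
  are irrelevant.\<close>

definition glue_rel :: "'e set \<Rightarrow> ('e \<times> real \<Rightarrow> 'v) \<Rightarrow> (('e \<times> real) \<times> ('e \<times> real)) set" where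
  "glue_rel E d = {(x, y). x \<in> E \<times> {0..1} \<and> y \<in> E \<times> {0..1} \<and>
                     (x = y \<or> snd x \<in> {0, 1} \<and> snd y \<in> {0, 1} \<and> d x = d y)}"

definition graph_space :: "'e set \<Rightarrow> ('e \<times> real \<Rightarrow> 'v) \<Rightarrow> ('e \<times> real) set topology" where
  "graph_space E d = quotient_topology (edge_space E) (glue_rel E d)"

definition graph_point :: "'e set \<Rightarrow> ('e \<times> real \<Rightarrow> 'v) \<Rightarrow> 'e \<times> real \<Rightarrow> ('e \<times> real) set" where
  "graph_point E d x = glue_rel E d `` {x}"

lemma topspace_edge_space [simp]: "topspace (edge_space E) = E \<times> {0..1}"
  by (auto simp: edge_space_def)

lemma equiv_glue_rel: "equiv (E \<times> {0..1}) (glue_rel E d)"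
  by (intro equivI refl_onI symI transI) (auto simp: glue_rel_def)

lemma quotient_map_graph_point: "quotient_map (edge_space E) (graph_space E d) (graph_point E d)"
  unfolding graph_space_def graph_point_def by (rule quotient_map_quotient_topology)

lemma graph_point_eq_iff:
  assumes "x \<in> E \<times> {0..1}" "y \<in> E \<times> {0..1}"
  shows "graph_point E d x = graph_point E d y \<longleftrightarrow>
           x = y \<or> snd x \<in> {0, 1} \<and> snd y \<in> {0, 1} \<and> d x = d y"
  unfolding graph_point_def eq_equiv_class_iff[OF equiv_glue_rel assms]
  using assms by (simp add: glue_rel_def)

lemma continuous_map_graph_point:
  assumes "e \<in> E" and "continuous_map Y (top_of_set {0..1}) \<phi>"
  shows "continuous_map Y (graph_space E d) (\<lambda>y. graph_point E d (e, \<phi> y))"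
proof -
  have "continuous_map (top_of_set {0..1}) (edge_space E) (Pair e)"
    unfolding edge_space_def using continuous_map_component_injection[OF assms(1), of "\<lambda>_. top_of_set {0..1::real}"] by simp
  from continuous_map_compose[OF continuous_map_compose[OF assms(2) this]
      quotient_imp_continuous_map[OF quotient_map_graph_point]]
  show ?thesis by (simp add: o_def)
qed

section \<open>Contraction of a non-loop edge\<close>

text \<open>A vertex exists in the graph space only as an end of some edge. The end
  \<open>t1\<close> of \<open>e1\<close> carries the merged vertex once \<open>e0\<close> is gone;
  without such an end, removing \<open>e0\<close> would erase that vertex.\<close>

locale edge_contraction =
  fixes E :: "'e set" and d :: "'e \<times> real \<Rightarrow> 'v" and e0 e1 :: 'e and t1 :: real
    and c :: "'v \<Rightarrow> 'v"
  assumes e0: "e0 \<in> E" and not_loop: "d (e0, 0) \<noteq> d (e0, 1)"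
    and c_def: "c = (\<lambda>v. if v = d (e0, 1) then d (e0, 0) else v)"
    and e1: "e1 \<in> E - {e0}" "t1 \<in> {0, 1}" "c (d (e1, t1)) = d (e0, 0)"
begin

abbreviation "a \<equiv> d (e0, 0)"
abbreviation "b \<equiv> d (e0, 1)"
abbreviation "E' \<equiv> E - {e0}"
abbreviation "q \<equiv> graph_point E d"
abbreviation "q' \<equiv> graph_point E' (c \<circ> d)"

lemma c_simps [simp]: "c a = a" "c b = a" "v \<noteq> b \<Longrightarrow> c v = v"
  by (auto simp: c_def)

lemma c_eq: "c v = c w \<longleftrightarrow> v = w \<or> v \<in> {a, b} \<and> w \<in> {a, b}"
  using not_loop by (auto simp: c_def)

lemma collapse_merged:
  assumes "e \<in> E'" "t \<in> {0, 1}" "d (e, t) \<in> {a, b}"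
  shows "q' (e1, t1) = q' (e, t)"
proof -
  have "c (d (e, t)) = a"
    using assms by auto
  then show ?thesis
    using assms e1 by (subst graph_point_eq_iff) auto
qed

text \<open>The path of edge \<open>e\<close>, prolonged at each end lying at the far end of \<open>e0\<close> by a detour
  along \<open>e0\<close>.\<close>

definition prolong :: "'e \<Rightarrow> real \<Rightarrow> 'e \<times> real" where
  "prolong e u =
     (if u \<le> 0 then (if d (e, 0) = b then (e0, 1 + u) else (e, 0))
      else if 1 \<le> u then (if d (e, 1) = b then (e0, 2 - u) else (e, 1))
      else (e, u))"

definition collapse :: "'e \<times> real \<Rightarrow> ('e \<times> real) set" where
  "collapse x = (if fst x = e0 then q' (e1, t1) else q' x)"

lemma prolong_in: "e \<in> E \<Longrightarrow> u \<in> {-1..2} \<Longrightarrow> prolong e u \<in> E \<times> {0..1}"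
  using e0 by (auto simp: prolong_def)

text \<open>\<open>prolong e\<close> jumps between edges at the parameters 0 and 1. The jumps vanish
  after gluing, because \<open>(e0, 1)\<close> and the end of \<open>e\<close> in question are the
  same vertex \<open>b\<close>.\<close>

lemma continuous_prolong:
  assumes e: "e \<in> E"
  shows "continuous_map (top_of_set {-1..2}) (graph_space E d) (\<lambda>u. q (prolong e u))"
proof -
  let ?A = "\<lambda>u. q (if d (e, 0) = b then (e0, 1 + u) else (e, 0))"
  let ?C = "\<lambda>u. q (if d (e, 1) = b then (e0, 2 - u) else (e, 1))"
  let ?I = "top_of_set {-1..2::real}"
  have A: "continuous_map (subtopology ?I {x \<in> topspace ?I. x \<le> 0}) (graph_space E d) ?A"
    by (cases "d (e, 0) = b"; simp only: if_True if_False simp_thms; rule continuous_map_graph_point)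
       (use e e0 in \<open>auto simp: subtopology_subtopology intro!: continuous_intros\<close>)
  have C: "continuous_map (top_of_set {1..2}) (graph_space E d) ?C"
    by (cases "d (e, 1) = b"; simp only: if_True if_False simp_thms; rule continuous_map_graph_point)
       (use e e0 in \<open>auto intro!: continuous_intros\<close>)
  have "continuous_map ?I (graph_space E d)
     (\<lambda>u. if u \<le> 0 then ?A u else if 1 \<le> u then ?C u else q (e, u))"
  proof (rule continuous_map_cases_le[OF _ _ A])
    show "continuous_map (subtopology ?I {x \<in> topspace ?I. 0 \<le> x}) (graph_space E d)
       (\<lambda>u. if 1 \<le> u then ?C u else q (e, u))"
    proof (rule continuous_map_cases_le)
      show "continuous_map (subtopology (subtopology ?I {x \<in> topspace ?I. 0 \<le> x})
          {x \<in> topspace (subtopology ?I {x \<in> topspace ?I. 0 \<le> x}). 1 \<le> x}) (graph_space E d) ?C"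
      proof -
        have "subtopology (subtopology ?I {x \<in> topspace ?I. 0 \<le> x})
          {x \<in> topspace (subtopology ?I {x \<in> topspace ?I. 0 \<le> x}). 1 \<le> x} = top_of_set {1..2}"
          by (simp add: subtopology_subtopology) (rule arg_cong[where f = "subtopology euclidean"], auto)
        with C show ?thesis by simp
      qed
      show "continuous_map (subtopology (subtopology ?I {x \<in> topspace ?I. 0 \<le> x})
          {x \<in> topspace (subtopology ?I {x \<in> topspace ?I. 0 \<le> x}). x \<le> 1}) (graph_space E d) (\<lambda>u. q (e, u))"
        by (rule continuous_map_graph_point[OF e]) (auto simp: subtopology_subtopology intro!: continuous_intros)
      show "?C x = q (e, x)" if "1 = x" "x \<in> topspace (subtopology ?I {x \<in> topspace ?I. 0 \<le> x})" for x
        using that e e0 by (auto simp: graph_point_eq_iff)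
    qed (auto simp: subtopology_subtopology intro!: continuous_intros)
  qed (use e e0 in \<open>auto simp: graph_point_eq_iff\<close>)
  then show ?thesis
    by (rule continuous_map_eq) (auto simp: prolong_def)
qed

lemma collapse_eq:
  assumes "x \<in> E \<times> {0..1}" "y \<in> E \<times> {0..1}" "q x = q y"
  shows "collapse x = collapse y"
proof (cases "x = y")
  case False
  with assms have *: "snd x \<in> {0, 1}" "snd y \<in> {0, 1}" "d x = d y"
    by (auto simp: graph_point_eq_iff)
  show ?thesis
  proof (cases "fst x = e0")
    case True
    then have "d x \<in> {a, b}"
      using * by (cases x) auto
    with True * show ?thesis
      using collapse_merged[of "fst y" "snd y"] assms(2) by (cases y) (auto simp: collapse_def)
  next
    case False
    note x = False
    show ?thesis
    proof (cases "fst y = e0")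
      case True
      then have "d y \<in> {a, b}"
        using * by (cases y) auto
      with True * x show ?thesis
        using collapse_merged[of "fst x" "snd x"] assms(1) by (cases x) (auto simp: collapse_def)
    next
      case False
      show ?thesis
      proof -
        have "q' x = q' y"
          using assms(1,2) * x False by (subst graph_point_eq_iff) auto
        with x False show ?thesis
          by (simp add: collapse_def)
      qed
    qed
  qed
qed auto

text \<open>A detour runs inside \<open>e0\<close> and goes to the merged vertex, to which the
  adjacent end of \<open>e\<close> also goes. Collapsing therefore leaves the path of
  \<open>e\<close> with a waiting time at each end.\<close>

lemma collapse_prolong:
  assumes "e \<in> E'" "u \<in> {-1..2}"
  shows "collapse (prolong e u) = q' (e, max 0 (min 1 u))"
proof -
  have "q' (e1, t1) = q' (e, t)" if "t \<in> {0, 1}" "d (e, t) = b" for t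
    using collapse_merged[of e t] that assms by auto
  then show ?thesis
    using assms by (auto simp: collapse_def prolong_def)
qed

lemma prolong_end:
  assumes "e \<in> E'" "t \<in> {0, 1}"
  shows "prolong e (3 * t - 1) = (if d (e, t) = b then (e0, 0) else (e, t))"
  using assms by (auto simp: prolong_def)

text \<open>The homotopy inverse of \<open>collapse\<close> traverses each remaining edge together
  with its detours, so that all ends at the merged vertex are sent to \<open>a\<close>.\<close>

lemma homotopy_equivalent_contract:
  "graph_space E d homotopy_equivalent_space graph_space E' (c \<circ> d)"
proof -
  \<comment> \<open>\<open>(1 + 2 * s) * t - s\<close> interpolates linearly between
    \<open>t\<close> and \<open>3 * t - 1\<close>, which maps the unit interval onto the parameter
    range of \<open>prolong\<close>. Meanwhile \<open>e0\<close> shrinks to its end 0. At time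
    \<open>s\<close> every edge end at \<open>b\<close> has reached \<open>(e0, 1 - s)\<close>, so
    the gluing is respected.\<close>
  define H where "H = (\<lambda>(s::real, (e, t)). q (if e = e0 then (e0, (1 - s) * t) else prolong e ((1 + 2 * s) * t - s)))"
  define K where "K = (\<lambda>(s::real, (e, t)). q' (e, max 0 (min 1 ((1 + 2 * s) * t - s))))"
  define g where "g = (\<lambda>(e, t). q (prolong e (3 * t - 1)))"
  have range: "(1 + 2 * s) * t - s \<in> {-1..2}" if "s \<in> {0..1}" "t \<in> {0..1}" for s t :: real
  proof -
    have "0 \<le> (1 + 2 * s) * t" "(1 + 2 * s) * t \<le> 1 + 2 * s"
      using that by (auto intro: mult_left_le)
    moreover have "-1 \<le> (1 + 2 * s) * t - s"
      using calculation(1) that unfolding atLeastAtMost_iff by linarith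
    moreover have "(1 + 2 * s) * t - s \<le> 2"
      using calculation(2) that unfolding atLeastAtMost_iff by linarith
    ultimately show ?thesis unfolding atLeastAtMost_iff by blast
  qed
  have H_end: "H (s, x) = (if d x = b then q (e0, 1 - s) else q x)"
    if "s \<in> {0..1}" "x \<in> E \<times> {0..1}" "snd x \<in> {0, 1}" for s x
    using that not_loop by (cases x) (auto simp: H_def prolong_def)
  have g_end: "g x = (if d x = b then q (e0, 0) else q x)"
    if "x \<in> E' \<times> {0..1}" "snd x \<in> {0, 1}" for x
    using that by (cases x) (simp add: g_def prolong_end split del: if_split, simp)
  have g_compat: "g x = g y"
    if "x \<in> E' \<times> {0..1}" "y \<in> E' \<times> {0..1}" "q' x = q' y" for x y
  proof (cases "x = y")
    case False
    with that have *: "snd x \<in> {0, 1}" "snd y \<in> {0, 1}" "c (d x) = c (d y)"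
      by (auto simp: graph_point_eq_iff)
    then show ?thesis
      using that e0 unfolding c_eq
      by (cases x; cases y) (simp add: g_end graph_point_eq_iff, metis)
  qed auto
  show ?thesis
  proof (rule homotopy_equivalent_space_quotients[where f = collapse and g = g and H = H and K = K,
          OF quotient_map_graph_point quotient_map_graph_point])
    show "continuous_map (edge_space E) (graph_space E' (c \<circ> d)) collapse"
      unfolding edge_space_def
    proof (rule continuous_map_from_sum_topology)
      fix e assume e: "e \<in> E"
      show "continuous_map (top_of_set {0..1}) (graph_space E' (c \<circ> d)) (\<lambda>t. collapse (e, t))"
        by (cases "e = e0"; simp only: collapse_def fst_conv if_True if_False simp_thms;
            rule continuous_map_graph_point) (use e e1 in auto)
    qed
    show "continuous_map (edge_space E') (graph_space E d) g"
      unfolding edge_space_def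
    proof (rule continuous_map_from_sum_topology)
      fix e assume "e \<in> E'"
      then have "continuous_map (top_of_set {0..1}) (graph_space E d) ((\<lambda>u. q (prolong e u)) \<circ> (\<lambda>t. 3 * t - 1))"
        by (intro continuous_map_compose[OF _ continuous_prolong]) (auto intro!: continuous_intros)
      then show "continuous_map (top_of_set {0..1}) (graph_space E d) (\<lambda>t. g (e, t))"
        by (simp add: g_def o_def)
    qed
    show "continuous_map (prod_topology (top_of_set {0..1}) (edge_space E)) (graph_space E d) H"
      unfolding edge_space_def
    proof (rule continuous_map_prod_sum_topology)
      fix e assume e: "e \<in> E"
      have "continuous_map (top_of_set ({0..1} \<times> {0..1})) (graph_space E d) (\<lambda>x. q (e0, (1 - fst x) * snd x))"
        by (rule continuous_map_graph_point[OF e0]) (auto intro!: continuous_intros mult_le_one)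
      moreover have "continuous_map (top_of_set ({0..1} \<times> {0..1})) (graph_space E d)
          ((\<lambda>u. q (prolong e u)) \<circ> (\<lambda>x. (1 + 2 * fst x) * snd x - fst x))"
        by (intro continuous_map_compose[OF _ continuous_prolong] e)
           (use range in \<open>auto simp del: atLeastAtMost_iff intro!: continuous_intros\<close>)
      ultimately show "continuous_map (prod_topology (top_of_set {0..1}) (top_of_set {0..1})) (graph_space E d)
          (\<lambda>(s, t). H (s, (e, t)))"
        by (cases "e = e0"; simp add: prod_top_of_set H_def case_prod_unfold o_def)
    qed
    show "continuous_map (prod_topology (top_of_set {0..1}) (edge_space E')) (graph_space E' (c \<circ> d)) K"
      unfolding edge_space_def
    proof (rule continuous_map_prod_sum_topology)
      fix e assume e: "e \<in> E'"
      have "continuous_map (top_of_set ({0..1} \<times> {0..1})) (graph_space E' (c \<circ> d))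
         (\<lambda>x. q' (e, max 0 (min 1 ((1 + 2 * fst x) * snd x - fst x))))"
        by (rule continuous_map_graph_point[OF e]) (auto intro!: continuous_intros)
      then show "continuous_map (prod_topology (top_of_set {0..1}) (top_of_set {0..1})) (graph_space E' (c \<circ> d))
          (\<lambda>(s, t). K (s, (e, t)))"
        by (simp add: prod_top_of_set K_def case_prod_unfold)
    qed
    show "collapse x = collapse y" if "x \<in> topspace (edge_space E)" "y \<in> topspace (edge_space E)" "q x = q y" for x y
      using that by (intro collapse_eq) simp_all
    show "g x = g y" if "x \<in> topspace (edge_space E')" "y \<in> topspace (edge_space E')" "q' x = q' y" for x y
      using that by (intro g_compat) simp_all
    show "H (s, x) = H (s, y)"
      if "s \<in> {0..1}" "x \<in> topspace (edge_space E)" "y \<in> topspace (edge_space E)" "q x = q y" for s x y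
    proof (cases "x = y")
      case False
      with that have *: "snd x \<in> {0, 1}" "snd y \<in> {0, 1}" "d x = d y"
        by (auto simp: graph_point_eq_iff)
      with that show ?thesis
        using H_end[of s x] H_end[of s y] by simp
    qed auto
    show "K (s, x) = K (s, y)"
      if "s \<in> {0..1}" "x \<in> topspace (edge_space E')" "y \<in> topspace (edge_space E')" "q' x = q' y" for s x y
    proof (cases "x = y")
      case False
      with that have *: "snd x \<in> {0, 1}" "snd y \<in> {0, 1}"
        by (auto simp: graph_point_eq_iff)
      have "K (s, z) = q' z" if "z \<in> {x, y}" for z
        using * \<open>s \<in> {0..1}\<close> that by (cases z) (auto simp: K_def)
      with \<open>q' x = q' y\<close> show ?thesis
        by simp
    qed auto
    show "H (0, x) = q x" if "x \<in> topspace (edge_space E)" for x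
      using that e0 by (cases x) (auto simp: H_def prolong_def graph_point_eq_iff)
    show "K (0, x) = q' x" if "x \<in> topspace (edge_space E')" for x
      using that by (cases x) (auto simp: K_def)
    show "H (1, x) = g y"
      if x: "x \<in> topspace (edge_space E)" and y: "y \<in> topspace (edge_space E')" and eq: "collapse x = q' y" for x y
    proof (cases "fst x = e0")
      case True
      then have "q' (e1, t1) = q' y"
        using eq by (simp add: collapse_def)
      \<comment> \<open>\<open>y\<close> is an arbitrary representative of the merged vertex. At the
        representative \<open>(e1, t1)\<close> the value of \<open>g\<close> is known: an end at
        \<open>b\<close> is detoured to \<open>a\<close>, and an end at \<open>a\<close> is already
        there.\<close>
      then have "g y = g (e1, t1)"
        using g_compat[of "(e1, t1)" y] y e1 by auto
      also have "\<dots> = q (e0, 0)"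
      proof -
        have "d (e1, t1) \<in> {a, b}"
          using e1(3) c_eq[of "d (e1, t1)" a] by simp
        moreover have "g (e1, t1) = (if d (e1, t1) = b then q (e0, 0) else q (e1, t1))"
          using e1 by (intro g_end) auto
        moreover have "q (e1, t1) = q (e0, 0)" if "d (e1, t1) = a"
          using e0 e1 that by (subst graph_point_eq_iff) auto
        ultimately show ?thesis by auto
      qed
      finally show ?thesis
        using True by (cases x) (simp add: H_def)
    next
      case False
      then have "H (1, x) = g x"
        by (cases x) (simp add: H_def g_def)
      with False show ?thesis
        using g_compat[of x y] x y eq by (cases x) (auto simp: collapse_def)
    qed
    show "K (1, y) = collapse x"
      if x: "x \<in> topspace (edge_space E)" and y: "y \<in> topspace (edge_space E')" and eq: "g y = q x" for x y
    proof -
      obtain e t where y': "y = (e, t)" "e \<in> E'" "t \<in> {0..1}"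
        using y unfolding topspace_edge_space by (rule SigmaE)
      then have u: "3 * t - 1 \<in> {-1..2}" by auto
      have "collapse x = collapse (prolong e (3 * t - 1))"
        using prolong_in[OF _ u, of e] eq x y' by (intro collapse_eq) (auto simp: g_def)
      then show ?thesis
        using collapse_prolong[OF y'(2) u] y' by (simp add: K_def)
    qed
  qed
qed

end

section \<open>Bouquets\<close>

definition arc_point :: "nat \<Rightarrow> nat \<times> real \<Rightarrow> (nat \<times> complex) set" where
  "arc_point n x = bouquet_rel n `` {(fst x, cis (2 * pi * snd x))}"

lemma cis_2pi_eq_iff:
  assumes "s \<in> {0..1}" "t \<in> {0..1}"
  shows "cis (2 * pi * s) = cis (2 * pi * t) \<longleftrightarrow> s = t \<or> s \<in> {0, 1} \<and> t \<in> {0, 1}"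
proof
  assume "cis (2 * pi * s) = cis (2 * pi * t)"
  then obtain n :: int where "2 * pi * s = 2 * pi * t + 2 * pi * n"
    using sin_cos_eq_iff[of "2 * pi * s" "2 * pi * t"] by (auto simp: cis.ctr complex_eq_iff)
  then have "2 * pi * (s - t - n) = 0"
    by (simp add: algebra_simps)
  then have n: "s - t = n"
    by simp
  then have "-1 \<le> n" "n \<le> 1"
    using assms by auto
  then consider "n = -1" | "n = 0" | "n = 1" by linarith
  then show "s = t \<or> s \<in> {0, 1} \<and> t \<in> {0, 1}"
    using n assms by cases auto
qed auto

lemma cis_2pi_eq_1_iff:
  assumes "t \<in> {0..1}"
  shows "cis (2 * pi * t) = 1 \<longleftrightarrow> t \<in> {0, 1}"
  using cis_2pi_eq_iff[OF assms, of 0] by auto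

lemma topspace_circles [simp]: "topspace (circles n) = {..<n} \<times> sphere 0 1"
  by (auto simp: circles_def)

lemma topspace_bouquet: "topspace (bouquet n) = (\<lambda>x. bouquet_rel n `` {x}) ` ({..<n} \<times> sphere 0 1)"
  by (auto simp: bouquet_def topspace_quotient_topology quotient_def)

lemma arc_point_eq_iff:
  assumes "x \<in> {..<n} \<times> {0..1}" "y \<in> {..<n} \<times> {0..1}"
  shows "arc_point n x = arc_point n y \<longleftrightarrow> x = y \<or> snd x \<in> {0, 1} \<and> snd y \<in> {0, 1}"
proof -
  let ?f = "\<lambda>x. (fst x, cis (2 * pi * snd x))"
  have "?f x \<in> topspace (circles n)" "?f y \<in> topspace (circles n)"
    using assms by auto
  then have "arc_point n x = arc_point n y \<longleftrightarrow> (?f x, ?f y) \<in> bouquet_rel n"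
    unfolding arc_point_def by (intro eq_equiv_class_iff[OF equiv_bouquet_rel])
  also have "\<dots> \<longleftrightarrow> x = y \<or> snd x \<in> {0, 1} \<and> snd y \<in> {0, 1}"
    using assms cis_2pi_eq_1_iff[of "snd x"] cis_2pi_eq_1_iff[of "snd y"] cis_2pi_eq_iff[of "snd x" "snd y"]
    by (cases x; cases y) (auto simp: bouquet_rel_def)
  finally show ?thesis .
qed

lemma continuous_map_arc_point:
  assumes "i < n"
  shows "continuous_map (top_of_set {0..1}) (bouquet n) (\<lambda>t. arc_point n (i, t))"
proof -
  have "continuous_map (top_of_set {0..1}) (top_of_set (sphere 0 1)) (\<lambda>t. cis (2 * pi * t))"
    by (auto intro!: continuous_intros)
  moreover have "continuous_map (top_of_set (sphere 0 1)) (circles n) (Pair i)"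
    unfolding circles_def
    using continuous_map_component_injection[of i "{..<n}" "\<lambda>_. top_of_set (sphere (0::complex) 1)"] assms
    by simp
  moreover have "continuous_map (circles n) (bouquet n) (\<lambda>x. bouquet_rel n `` {x})"
    unfolding bouquet_def by (intro quotient_imp_continuous_map quotient_map_quotient_topology)
  ultimately have "continuous_map (top_of_set {0..1}) (bouquet n)
      ((\<lambda>x. bouquet_rel n `` {x}) \<circ> (Pair i \<circ> (\<lambda>t. cis (2 * pi * t))))"
    by (intro continuous_map_compose)
  then show ?thesis
    by (simp add: o_def arc_point_def)
qed

lemma image_arc_point: "arc_point n ` ({..<n} \<times> {0..1}) = topspace (bouquet n)"
proof -
  have "\<exists>t\<in>{0..1}. z = cis (2 * pi * t)" if "z \<in> sphere 0 1" for z
  proof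
    show "Arg2pi z / (2 * pi) \<in> {0..1}"
      using Arg2pi_ge_0[of z] Arg2pi_lt_2pi[of z] by (auto simp: divide_simps)
    show "z = cis (2 * pi * (Arg2pi z / (2 * pi)))"
      using Arg2pi_eq[of z] that by (simp add: cis_conv_exp)
  qed
  then show ?thesis
    unfolding topspace_bouquet arc_point_def by (force simp: image_iff)
qed

text \<open>Distinct points are separated by the retractions onto the single circles.\<close>

lemma Hausdorff_space_bouquet: "Hausdorff_space (bouquet n)"
  unfolding Hausdorff_space_def
proof (intro allI impI)
  fix p p' assume "p \<in> topspace (bouquet n) \<and> p' \<in> topspace (bouquet n) \<and> p \<noteq> p'"
  then obtain x y where xy: "x \<in> {..<n} \<times> sphere 0 1" "y \<in> {..<n} \<times> sphere 0 1"
    "p = bouquet_rel n `` {x}" "p' = bouquet_rel n `` {y}" "p \<noteq> p'"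
    unfolding topspace_bouquet by blast
  then have neq: "(x, y) \<notin> bouquet_rel n"
    using eq_equiv_class_iff[OF equiv_bouquet_rel, of x n y] by simp
  define \<rho> where "\<rho> = (\<lambda>i (x :: nat \<times> complex). if fst x = i then snd x else 1)"
  have cont: "continuous_map (circles n) euclidean (\<rho> i)" for i
    unfolding circles_def
    by (rule continuous_map_from_sum_topology)
       (auto simp: \<rho>_def intro!: continuous_intros)
  have compat: "\<rho> i x = \<rho> i y" if "x \<in> topspace (circles n)" "y \<in> topspace (circles n)"
    "bouquet_rel n `` {x} = bouquet_rel n `` {y}" for i x y
  proof -
    have "(x, y) \<in> bouquet_rel n"
      using that(3) eq_equiv_class_iff[OF equiv_bouquet_rel that(1,2)] by simp
    then show ?thesis
      by (auto simp: bouquet_rel_def \<rho>_def)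
  qed
  \<comment> \<open>The retractions onto the circles of \<open>x\<close> and of \<open>y\<close>
    suffice: on a common circle they compare the points themselves, and on different circles each
    shows one point to be the base point.\<close>
  have "\<exists>i. \<rho> i x \<noteq> \<rho> i y"
  proof (rule ccontr)
    assume *: "\<not> ?thesis"
    then have *: "\<rho> (fst x) x = \<rho> (fst x) y" "\<rho> (fst y) x = \<rho> (fst y) y"
      by blast+
    have "x = y \<or> snd x = 1 \<and> snd y = 1"
    proof (cases "fst x = fst y")
      case True
      with *(1) show ?thesis by (simp add: \<rho>_def prod_eq_iff)
    next
      case False
      with * show ?thesis by (simp add: \<rho>_def)
    qed
    with neq xy(1,2) show False
      by (simp add: bouquet_rel_def)
  qed
  then obtain i where i: "\<rho> i x \<noteq> \<rho> i y" ..
  have Q: "quotient_map (circles n) (bouquet n) (\<lambda>x. bouquet_rel n `` {x})"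
    unfolding bouquet_def by (rule quotient_map_quotient_topology)
  obtain r where r: "continuous_map (bouquet n) euclidean r" "r ` topspace (bouquet n) = \<rho> i ` topspace (circles n)"
    "\<And>x. x \<in> topspace (circles n) \<Longrightarrow> r (bouquet_rel n `` {x}) = \<rho> i x"
    by (rule quotient_map_lift_exists[OF Q cont[of i]]) ((rule compat; assumption) | (rule that; assumption))+
  have "r p \<noteq> r p'"
    using r(3)[of x] r(3)[of y] xy i by simp
  then obtain U V where UV: "open U" "open V" "r p \<in> U" "r p' \<in> V" "U \<inter> V = {}"
    by (meson hausdorff)
  let ?pre = "\<lambda>U. {z \<in> topspace (bouquet n). r z \<in> U}"
  have "openin (bouquet n) (?pre U)" "openin (bouquet n) (?pre V)"
    using UV r(1) by (auto intro!: openin_continuous_map_preimage)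
  moreover have "p \<in> ?pre U" "p' \<in> ?pre V" "disjnt (?pre U) (?pre V)"
    using UV xy by (auto simp: topspace_bouquet disjnt_def)
  ultimately show "\<exists>U V. openin (bouquet n) U \<and> openin (bouquet n) V \<and> p \<in> U \<and> p' \<in> V \<and> disjnt U V"
    by blast
qed

lemma compact_space_edge_space:
  assumes "finite E"
  shows "compact_space (edge_space E)"
proof -
  have "compactin (edge_space E) (Pair e ` {0..1})" if "e \<in> E" for e
  proof (rule image_compactin)
    show "compactin (top_of_set {0..1::real}) {0..1}"
      by (simp add: compactin_subtopology)
    show "continuous_map (top_of_set {0..1}) (edge_space E) (Pair e)"
      unfolding edge_space_def
      using continuous_map_component_injection[OF that, of "\<lambda>_. top_of_set {0..1::real}"] by simp
  qed
  then have "compactin (edge_space E) (\<Union>e\<in>E. Pair e ` {0..1})"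
    using assms by (intro compactin_Union) auto
  moreover have "(\<Union>e\<in>E. Pair e ` {0..1}) = topspace (edge_space E)"
    by auto
  ultimately show ?thesis
    by (simp add: compact_space_def)
qed

text \<open>A continuous surjection from a compact space onto a Hausdorff space is a quotient map.
  This presents the bouquet by intervals, in the same way as a graph space.\<close>

lemma quotient_map_arc_point: "quotient_map (edge_space {..<n}) (bouquet n) (arc_point n)"
proof (rule continuous_imp_quotient_map)
  show "continuous_map (edge_space {..<n}) (bouquet n) (arc_point n)"
    unfolding edge_space_def
    by (rule continuous_map_from_sum_topology) (simp add: continuous_map_arc_point)
qed (simp_all add: compact_space_edge_space Hausdorff_space_bouquet image_arc_point)

text \<open>With a single vertex the gluing identifies exactly the ends of all edges, as for the
  arcs of a bouquet. Renumbering the edges gives mutually inverse maps, so constant homotopies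
  suffice.\<close>

lemma graph_space_one_vertex:
  assumes "finite E" and d: "\<And>e t. e \<in> E \<Longrightarrow> t \<in> {0, 1} \<Longrightarrow> d (e, t) = v"
  shows "graph_space E d homotopy_equivalent_space bouquet (card E)"
proof -
  obtain h where h: "bij_betw h E {..<card E}"
    using ex_bij_betw_finite_nat[OF assms(1)] by (auto simp: atLeast0LessThan)
  define k where "k = the_inv_into E h"
  have hE: "h e < card E" if "e \<in> E" for e
    using h that by (auto simp: bij_betw_def)
  have kE: "k i \<in> E" if "i < card E" for i
    using bij_betw_the_inv_into[OF h] that by (auto simp: k_def bij_betw_def)
  have kh: "k (h e) = e" if "e \<in> E" for e
    using h that by (simp add: k_def the_inv_into_f_f bij_betw_def)
  have hk: "h (k i) = i" if "i < card E" for i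
    using h that by (simp add: k_def f_the_inv_into_f_bij_betw)
  let ?n = "card E"
  let ?f = "\<lambda>x. arc_point ?n (h (fst x), snd x)" and ?g = "\<lambda>x. graph_point E d (k (fst x), snd x)"
  have h_eq: "h e = h e' \<longleftrightarrow> e = e'" if "e \<in> E" "e' \<in> E" for e e'
    using kh[OF that(1)] kh[OF that(2)] by metis
  have q_eq: "graph_point E d x = graph_point E d y \<longleftrightarrow> ?f x = ?f y"
    if "x \<in> E \<times> {0..1}" "y \<in> E \<times> {0..1}" for x y
  proof -
    obtain e t e' t' where eq: "x = (e, t)" "y = (e', t')"
      by (metis surj_pair)
    with that have xy: "x = (e, t)" "y = (e', t')" "e \<in> E" "e' \<in> E" "t \<in> {0..1}" "t' \<in> {0..1}"
      by simp_all
    have "graph_point E d x = graph_point E d y \<longleftrightarrow> (e, t) = (e', t') \<or> t \<in> {0, 1} \<and> t' \<in> {0, 1} \<and> d (e, t) = d (e', t')"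
      using xy by (subst graph_point_eq_iff) simp_all
    also have "\<dots> \<longleftrightarrow> (h e, t) = (h e', t') \<or> t \<in> {0, 1} \<and> t' \<in> {0, 1}"
      using d[OF xy(3)] d[OF xy(4)] h_eq[OF xy(3,4)] by auto
    also have "\<dots> \<longleftrightarrow> ?f x = ?f y"
      using xy hE by (subst arc_point_eq_iff) simp_all
    finally show ?thesis .
  qed
  have g_f: "?g (h (fst x), snd x) = graph_point E d x" if "x \<in> E \<times> {0..1}" for x
    using that kh by (cases x) auto
  have f_g: "?f (k (fst y), snd y) = arc_point ?n y" if "y \<in> {..<?n} \<times> {0..1}" for y
    using that hk by (cases y) auto
  have b_eq: "arc_point ?n x = arc_point ?n y \<longleftrightarrow> ?g x = ?g y"
    if "x \<in> {..<?n} \<times> {0..1}" "y \<in> {..<?n} \<times> {0..1}" for x y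
  proof -
    have "?g x = ?g y \<longleftrightarrow> ?f (k (fst x), snd x) = ?f (k (fst y), snd y)"
      using that kE by (intro q_eq) auto
    then show ?thesis
      by (simp only: f_g that)
  qed
  show ?thesis
  proof (rule homotopy_equivalent_space_quotients[where f = ?f and g = ?g
        and H = "graph_point E d \<circ> snd" and K = "arc_point ?n \<circ> snd",
        OF quotient_map_graph_point quotient_map_arc_point])
    show "continuous_map (edge_space E) (bouquet ?n) ?f"
      unfolding edge_space_def
      by (rule continuous_map_from_sum_topology) (simp add: continuous_map_arc_point hE)
    show "continuous_map (edge_space {..<?n}) (graph_space E d) ?g"
      unfolding edge_space_def
    proof (rule continuous_map_from_sum_topology)
      fix i assume "i \<in> {..<?n}"
      then show "continuous_map (top_of_set {0..1}) (graph_space E d) (\<lambda>t. ?g (i, t))"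
        unfolding fst_conv snd_conv by (intro continuous_map_graph_point) (auto simp: kE)
    qed
    show "continuous_map (prod_topology (top_of_set {0..1}) (edge_space E)) (graph_space E d) (graph_point E d \<circ> snd)"
      by (rule continuous_map_compose[OF continuous_map_snd quotient_imp_continuous_map[OF quotient_map_graph_point]])
    show "continuous_map (prod_topology (top_of_set {0..1}) (edge_space {..<?n})) (bouquet ?n) (arc_point ?n \<circ> snd)"
      by (rule continuous_map_compose[OF continuous_map_snd quotient_imp_continuous_map[OF quotient_map_arc_point]])
    show "?f x = ?f y" if "x \<in> topspace (edge_space E)" "y \<in> topspace (edge_space E)"
      "graph_point E d x = graph_point E d y" for x y
      using that q_eq[of x y] by simp
    show "?g x = ?g y" if "x \<in> topspace (edge_space {..<?n})" "y \<in> topspace (edge_space {..<?n})"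
      "arc_point ?n x = arc_point ?n y" for x y
      using that b_eq[of x y] by simp
    show "(graph_point E d \<circ> snd) (1, x) = ?g y"
      if "x \<in> topspace (edge_space E)" "y \<in> topspace (edge_space {..<?n})" "?f x = arc_point ?n y" for x y
    proof -
      have "?g (h (fst x), snd x) = ?g y"
        using that hE by (subst b_eq[symmetric]) auto
      then show ?thesis
        using g_f[of x] that by simp
    qed
    show "(arc_point ?n \<circ> snd) (1, y) = ?f x"
      if "x \<in> topspace (edge_space E)" "y \<in> topspace (edge_space {..<?n})" "?g y = graph_point E d x" for x y
    proof -
      have "?f (k (fst y), snd y) = ?f x"
        using that kE by (subst q_eq[symmetric]) auto
      then show ?thesis
        using f_g[of y] that by simp
    qed
  qed simp_all
qed

section \<open>Reduction of connected graphs to bouquets\<close>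

definition vertices :: "'e set \<Rightarrow> ('e \<times> real \<Rightarrow> 'v) \<Rightarrow> 'v set" where
  "vertices E d = d ` (E \<times> {0, 1})"

text \<open>Connectedness is expressed by vertex sets that no edge leaves, not by paths, so that it
  passes to a contraction by taking preimages.\<close>

definition connected_graph :: "'e set \<Rightarrow> ('e \<times> real \<Rightarrow> 'v) \<Rightarrow> bool" where
  "connected_graph E d \<longleftrightarrow>
     (\<forall>S. (\<forall>e\<in>E. d (e, 0) \<in> S \<longleftrightarrow> d (e, 1) \<in> S) \<longrightarrow> vertices E d \<subseteq> S \<or> vertices E d \<inter> S = {})"

lemma connected_graphD:
  assumes "connected_graph E d" and "\<And>e. e \<in> E \<Longrightarrow> d (e, 0) \<in> S \<longleftrightarrow> d (e, 1) \<in> S"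
    and "v \<in> vertices E d" "v \<in> S"
  shows "vertices E d \<subseteq> S"
  using assms unfolding connected_graph_def by blast

lemma vertices_iff: "v \<in> vertices E d \<longleftrightarrow> (\<exists>e\<in>E. v = d (e, 0) \<or> v = d (e, 1))"
  unfolding vertices_def by (auto simp: image_iff)

lemma finite_vertices: "finite E \<Longrightarrow> finite (vertices E d)"
  by (simp add: vertices_def)

text \<open>\<open>a\<close> survives because of the end \<open>t1\<close> of \<open>e1\<close>; a
  vertex other than \<open>a\<close> and \<open>b\<close> is an end of some edge different from
  \<open>e0\<close>.\<close>

lemma (in edge_contraction) contracted_vertices:
  "vertices E' (c \<circ> d) = vertices E d - {b}"
proof -
  have a: "a \<in> vertices E' (c \<circ> d)"
  proof -
    have "d (e1, t1) = d (e1, 0) \<or> d (e1, t1) = d (e1, 1)"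
      using e1(2) by auto
    then show ?thesis
      using e1(1,3) unfolding vertices_iff by (metis comp_apply)
  qed
  have other: "v \<in> vertices E' (c \<circ> d)" if "v \<in> vertices E d" "v \<noteq> a" "v \<noteq> b" for v
  proof -
    obtain e where e: "e \<in> E" "v = d (e, 0) \<or> v = d (e, 1)"
      using \<open>v \<in> vertices E d\<close> unfolding vertices_iff by blast
    have "e \<noteq> e0"
      using e that by blast
    moreover have "c v = v"
      using that by simp
    ultimately show ?thesis
      using e unfolding vertices_iff by (metis Diff_iff comp_apply singletonD)
  qed
  have image: "c v \<in> vertices E d - {b}" if "v \<in> vertices E d" for v
    using that e0 not_loop by (cases "v = b") (auto simp: vertices_iff)
  show ?thesis
  proof (intro equalityI subsetI)
    fix v assume "v \<in> vertices E' (c \<circ> d)"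
    then obtain w where "w \<in> vertices E d" "v = c w"
      unfolding vertices_iff by auto
    then show "v \<in> vertices E d - {b}"
      using image[of w] by simp
  next
    fix v assume "v \<in> vertices E d - {b}"
    then show "v \<in> vertices E' (c \<circ> d)"
      using a other[of v] by (cases "v = a") auto
  qed
qed

text \<open>The preimage under \<open>c\<close> of a set respecting the remaining edges respects
  \<open>e0\<close> as well, since \<open>c\<close> gives both ends of \<open>e0\<close> the same
  value.\<close>

lemma (in edge_contraction) contracted_connected:
  assumes "connected_graph E d"
  shows "connected_graph E' (c \<circ> d)"
  unfolding connected_graph_def
proof (intro allI impI)
  fix S assume S: "\<forall>e\<in>E'. (c \<circ> d) (e, 0) \<in> S \<longleftrightarrow> (c \<circ> d) (e, 1) \<in> S"
  have *: "d (e, 0) \<in> c -` S \<longleftrightarrow> d (e, 1) \<in> c -` S" if "e \<in> E" for e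
    using S that by (cases "e = e0") auto
  have "vertices E d \<subseteq> c -` S \<or> vertices E d \<inter> c -` S = {}"
    using connected_graphD[OF assms *] by blast
  then show "vertices E' (c \<circ> d) \<subseteq> S \<or> vertices E' (c \<circ> d) \<inter> S = {}"
    unfolding contracted_vertices by auto
qed

text \<open>A contraction lowers the numbers of edges and vertices by one each, so their difference
  persists until only loops at one vertex are left. The bound on the vertices excludes trees: a tree
  is contractible, whereas \<open>bouquet 0\<close> is empty.\<close>

theorem connected_graph_homotopy_equivalent_bouquet:
  assumes "finite E" "E \<noteq> {}" "connected_graph E d" "card (vertices E d) \<le> card E"
  shows "graph_space E d homotopy_equivalent_space bouquet (card E + 1 - card (vertices E d))"
  using assms
proof (induction "card E" arbitrary: E d rule: less_induct)
  case less
  note fin = finite_vertices[OF \<open>finite E\<close>, of d]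
  have "vertices E d \<noteq> {}"
    using \<open>E \<noteq> {}\<close> by (auto simp: vertices_def)
  then obtain v where v: "v \<in> vertices E d" by blast
  show ?case
  proof (cases "\<exists>e0\<in>E. d (e0, 0) \<noteq> d (e0, 1)")
    case False
    then have "vertices E d \<subseteq> {v}"
      using less.prems(3) v by (intro connected_graphD[of E d "{v}"]) auto
    then have V: "vertices E d = {v}"
      using v by blast
    have "d (e, t) = v" if "e \<in> E" "t \<in> {0, 1}" for e t
      using V that unfolding vertices_def by blast
    then show ?thesis
      using graph_space_one_vertex[OF \<open>finite E\<close>, of d v] V by simp
  next
    case True
    then obtain e0 where e0: "e0 \<in> E" "d (e0, 0) \<noteq> d (e0, 1)" by blast
    define c where "c = (\<lambda>v. if v = d (e0, 1) then d (e0, 0) else v)"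
    have "\<exists>e1\<in>E - {e0}. \<exists>t1\<in>{0, 1}. c (d (e1, t1)) = d (e0, 0)"
    proof (rule ccontr)
      assume none: "\<not> ?thesis"
      \<comment> \<open>If no other edge meets \<open>e0\<close>, its two ends form a set that no
        edge leaves. By connectedness they are all the vertices, so \<open>e0\<close> is the only
        edge, and two vertices exceed one edge.\<close>
      let ?S = "{d (e0, 0), d (e0, 1)}"
      have off: "d (e, 0) \<notin> ?S \<and> d (e, 1) \<notin> ?S" if "e \<in> E - {e0}" for e
      proof -
        have "c (d (e, 0)) \<noteq> d (e0, 0)" "c (d (e, 1)) \<noteq> d (e0, 0)"
          using none that by blast+
        then show ?thesis
          unfolding c_def by (metis insertE singletonD)
      qed
      have "d (e, 0) \<in> ?S \<longleftrightarrow> d (e, 1) \<in> ?S" if "e \<in> E" for e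
        using off[of e] that by (cases "e = e0") auto
      then have sub: "vertices E d \<subseteq> ?S"
        using connected_graphD[OF less.prems(3), of ?S "d (e0, 0)"] e0 by (auto simp: vertices_iff)
      have "E \<subseteq> {e0}"
      proof
        fix e assume e: "e \<in> E"
        then have "d (e, 0) \<in> ?S"
          using sub unfolding vertices_def by blast
        then show "e \<in> {e0}"
          using off[of e] e by blast
      qed
      then have "card E \<le> 1"
        using card_mono[of "{e0}" E] by simp
      moreover have "?S \<subseteq> vertices E d"
        using e0 by (auto simp: vertices_iff)
      then have "2 \<le> card (vertices E d)"
        using card_mono[OF fin, of ?S] e0(2) by simp
      ultimately show False
        using less.prems(4) by simp
    qed
    then obtain e1 t1 where e1: "e1 \<in> E - {e0}" "t1 \<in> {0, 1}" "c (d (e1, t1)) = d (e0, 0)"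
      by blast
    interpret edge_contraction E d e0 e1 t1 c
      by unfold_locales (use e0 e1 c_def in auto)
    have V: "card (vertices E' (c \<circ> d)) = card (vertices E d) - 1" "0 < card (vertices E d)"
    proof -
      have "d (e0, 1) \<in> vertices E d"
        using e0 unfolding vertices_iff by blast
      then show "card (vertices E' (c \<circ> d)) = card (vertices E d) - 1" "0 < card (vertices E d)"
        unfolding contracted_vertices using fin by (auto simp: card_gt_0_iff)
    qed
    have E: "card E' = card E - 1" "card E' < card E"
      using e0(1) less.prems(1) card_Diff1_less[of E e0] by auto
    have "graph_space E' (c \<circ> d) homotopy_equivalent_space
        bouquet (card E' + 1 - card (vertices E' (c \<circ> d)))"
    proof (rule less.hyps[OF E(2)])
      show "finite E'" "E' \<noteq> {}"
        using less.prems(1) e1(1) by blast+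
      show "connected_graph E' (c \<circ> d)"
        using less.prems(3) by (rule contracted_connected)
      show "card (vertices E' (c \<circ> d)) \<le> card E'"
        using V E less.prems(4) by simp
    qed
    moreover have "card E' + 1 - card (vertices E' (c \<circ> d)) = card E + 1 - card (vertices E d)"
      using V E less.prems(4) by simp
    ultimately show ?thesis
      using homotopy_eqv_trans[OF homotopy_equivalent_contract] by simp
  qed
qed

section \<open>Coordinates on the configuration space\<close>

text \<open>Each circle is parametrised by \<open>[-1, 1]\<close> with both ends at the base point, so that
  \<open>1 - \<bar>u\<bar>\<close> measures the distance to the base point.\<close>

definition circle_point :: "nat \<Rightarrow> nat \<Rightarrow> real \<Rightarrow> (nat \<times> complex) set" where
  "circle_point k i u = arc_point k (i, (u + 1) / 2)"

lemma circle_point_eq_iff: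
  assumes "i < k" "j < k" "\<bar>u\<bar> \<le> 1" "\<bar>v\<bar> \<le> 1"
  shows "circle_point k i u = circle_point k j v \<longleftrightarrow> i = j \<and> u = v \<or> \<bar>u\<bar> = 1 \<and> \<bar>v\<bar> = 1"
proof -
  have "circle_point k i u = circle_point k j v \<longleftrightarrow>
      (i, (u + 1) / 2) = (j, (v + 1) / 2) \<or> (u + 1) / 2 \<in> {0, 1} \<and> (v + 1) / 2 \<in> {0, 1}"
    unfolding circle_point_def using assms by (subst arc_point_eq_iff) auto
  also have "\<dots> \<longleftrightarrow> i = j \<and> u = v \<or> \<bar>u\<bar> = 1 \<and> \<bar>v\<bar> = 1"
    by auto
  finally show ?thesis .
qed

lemma continuous_map_circle_point:
  assumes "i < k" "continuous_map Y (top_of_set {-1..1}) \<phi>"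
  shows "continuous_map Y (bouquet k) (\<lambda>y. circle_point k i (\<phi> y))"
proof -
  have "continuous_map (top_of_set {-1..1}) (top_of_set {0..1}) (\<lambda>u::real. (u + 1) / 2)"
    by (auto intro!: continuous_intros)
  from continuous_map_compose[OF continuous_map_compose[OF assms(2) this] continuous_map_arc_point[OF assms(1)]]
  show ?thesis
    by (simp add: o_def circle_point_def)
qed

lemma circle_point_in: "i < k \<Longrightarrow> \<bar>u\<bar> \<le> 1 \<Longrightarrow> circle_point k i u \<in> topspace (bouquet k)"
  unfolding circle_point_def image_arc_point[symmetric] by (rule imageI) auto

lemma topspace_bouquetE:
  assumes "x \<in> topspace (bouquet k)"
  obtains i u where "x = circle_point k i u" "i < k" "u \<in> {-1..1}"
proof -
  obtain i t where "x = arc_point k (i, t)" "i < k" "t \<in> {0..1}"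
    using assms unfolding image_arc_point[symmetric] by auto
  then show thesis
    by (intro that[of i "2 * t - 1"]) (simp_all add: circle_point_def)
qed

definition upair :: "nat \<Rightarrow> (nat \<times> complex) set \<Rightarrow> (nat \<times> complex) set
    \<Rightarrow> ((nat \<times> complex) set \<times> (nat \<times> complex) set) set" where
  "upair k P Q = swap_rel (bouquet k) `` {(P, Q)}"

lemma topspace_ordered_conf2: "topspace (ordered_conf2 X) = {(x, y). x \<in> topspace X \<and> y \<in> topspace X \<and> x \<noteq> y}"
  by (auto simp: ordered_conf2_def)

lemma upair_eq_iff:
  assumes "(P, Q) \<in> topspace (ordered_conf2 (bouquet k))" "(P', Q') \<in> topspace (ordered_conf2 (bouquet k))"
  shows "upair k P Q = upair k P' Q' \<longleftrightarrow> P = P' \<and> Q = Q' \<or> P = Q' \<and> Q = P'"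
  unfolding upair_def eq_equiv_class_iff[OF equiv_swap_rel assms]
  using assms by (auto simp: swap_rel_def)

lemma upair_commute:
  assumes "(P, Q) \<in> topspace (ordered_conf2 (bouquet k))"
  shows "upair k P Q = upair k Q P"
  using assms by (subst upair_eq_iff) (auto simp: topspace_ordered_conf2)

lemma quotient_map_upair:
  "quotient_map (ordered_conf2 (bouquet k)) (unordered_conf2 (bouquet k)) (\<lambda>(P, Q). upair k P Q)"
  using quotient_map_quotient_topology[of "ordered_conf2 (bouquet k)" "swap_rel (bouquet k)"]
  by (simp add: unordered_conf2_def upair_def case_prod_unfold)

text \<open>The sector \<open>(i, j, s)\<close> consists of the pairs with an outer point \<open>v\<close> on circle \<open>j\<close> and an
  inner point, at most as far from the base point, on the half of sign \<open>s\<close> of circle \<open>i\<close>; the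
  coordinate \<open>\<rho>\<close> is the ratio of the two distances.  For \<open>i = j\<close> and \<open>\<rho> = 1\<close> the points have to
  be opposite in order to be distinct.\<close>

definition sector :: "nat \<times> nat \<times> real \<Rightarrow> (real \<times> real) set" where
  "sector = (\<lambda>(i, j, s). {(\<rho>, v). 0 \<le> \<rho> \<and> \<rho> \<le> 1 \<and> \<bar>v\<bar> < 1 \<and> (i = j \<and> \<rho> = 1 \<longrightarrow> s * v < 0)})"

text \<open>Solves \<open>1 - \<bar>u\<bar> = \<rho> * (1 - \<bar>v\<bar>)\<close> for the
  coordinate \<open>u\<close> on the half of sign \<open>s\<close>.\<close>

definition inner_coord :: "real \<Rightarrow> real \<times> real \<Rightarrow> real" where
  "inner_coord s = (\<lambda>(\<rho>, v). s * (1 - \<rho> * (1 - \<bar>v\<bar>)))"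

definition sector_point :: "nat \<Rightarrow> (nat \<times> nat \<times> real) \<times> real \<times> real \<Rightarrow> _" where
  "sector_point k = (\<lambda>((i, j, s), x). upair k (circle_point k i (inner_coord s x)) (circle_point k j (snd x)))"

definition sectors :: "nat \<Rightarrow> (nat \<times> nat \<times> real) set" where
  "sectors k = {..<k} \<times> {..<k} \<times> {-1, 1}"

definition sector_space :: "nat \<Rightarrow> ((nat \<times> nat \<times> real) \<times> real \<times> real) topology" where
  "sector_space k = sum_topology (\<lambda>e. top_of_set (sector e)) (sectors k)"

lemma sectorsE:
  assumes "e \<in> sectors k"
  obtains i j s where "e = (i, j, s)" "i < k" "j < k" "s \<in> {-1, 1}"
  using assms unfolding sectors_def by blast

lemma sector_iff: "(\<rho>, v) \<in> sector (i, j, s) \<longleftrightarrow>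
    0 \<le> \<rho> \<and> \<rho> \<le> 1 \<and> \<bar>v\<bar> < 1 \<and> (i = j \<and> \<rho> = 1 \<longrightarrow> s * v < 0)"
  by (simp add: sector_def)

lemma inner_coord_bounds:
  assumes "0 \<le> \<rho>" "\<rho> \<le> 1" "\<bar>v\<bar> < 1" "s \<in> {-1, 1}"
  shows "1 - \<bar>inner_coord s (\<rho>, v)\<bar> = \<rho> * (1 - \<bar>v\<bar>)" "\<bar>inner_coord s (\<rho>, v)\<bar> \<le> 1"
    "\<bar>inner_coord s (\<rho>, v)\<bar> = 1 \<longleftrightarrow> \<rho> = 0"
proof -
  have "0 \<le> \<rho> * (1 - \<bar>v\<bar>)" "\<rho> * (1 - \<bar>v\<bar>) \<le> 1"
    using assms by (auto intro: mult_le_one)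
  moreover from this have eq: "\<bar>inner_coord s (\<rho>, v)\<bar> = 1 - \<rho> * (1 - \<bar>v\<bar>)"
    using assms(4) by (auto simp: inner_coord_def)
  ultimately show "1 - \<bar>inner_coord s (\<rho>, v)\<bar> = \<rho> * (1 - \<bar>v\<bar>)" "\<bar>inner_coord s (\<rho>, v)\<bar> \<le> 1"
    by simp_all
  show "\<bar>inner_coord s (\<rho>, v)\<bar> = 1 \<longleftrightarrow> \<rho> = 0"
    unfolding eq using assms(3) by simp
qed

text \<open>The outer point is not the base point, so a collision needs a common circle. Equal
  distances then force \<open>\<rho> = 1\<close>, and the outer point lies on the half of sign
  \<open>s\<close> or at the middle, which \<open>sector\<close> excludes.\<close>

lemma sector_pair_in:
  assumes "(i, j, s) \<in> sectors k" "(\<rho>, v) \<in> sector (i, j, s)"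
  shows "(circle_point k i (inner_coord s (\<rho>, v)), circle_point k j v) \<in> topspace (ordered_conf2 (bouquet k))"
proof -
  have *: "0 \<le> \<rho>" "\<rho> \<le> 1" "\<bar>v\<bar> < 1" "i = j \<and> \<rho> = 1 \<Longrightarrow> s * v < 0" and k: "i < k" "j < k" "s \<in> {-1, 1}"
    using assms by (auto simp: sector_iff sectors_def)
  note b = inner_coord_bounds[OF *(1-3) k(3)]
  have "circle_point k i (inner_coord s (\<rho>, v)) \<noteq> circle_point k j v"
  proof
    assume "circle_point k i (inner_coord s (\<rho>, v)) = circle_point k j v"
    then have ij: "i = j" "inner_coord s (\<rho>, v) = v"
      using b(2) * k by (auto simp: circle_point_eq_iff)
    then have "\<rho> * (1 - \<bar>v\<bar>) = 1 * (1 - \<bar>v\<bar>)"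
      using b(1) by simp
    then have \<rho>: "\<rho> = 1"
      using *(3) by (simp only: mult_cancel_right) auto
    then have "v = s * \<bar>v\<bar>"
      using ij(2) by (simp add: inner_coord_def)
    then have "s * v = \<bar>v\<bar>"
      using k(3) by auto
    with * \<rho> ij show False by auto
  qed
  then show ?thesis
    using b(2) * k by (auto simp: topspace_ordered_conf2 intro!: circle_point_in)
qed

lemma continuous_map_sector_point:
  assumes "e \<in> sectors k"
  shows "continuous_map (top_of_set (sector e)) (unordered_conf2 (bouquet k)) (\<lambda>x. sector_point k (e, x))"
proof -
  obtain i j s where e: "e = (i, j, s)" "i < k" "j < k" "s \<in> {-1, 1}"
    using assms by (rule sectorsE)
  have "continuous_map (top_of_set (sector e)) (bouquet k) (\<lambda>x. circle_point k i (inner_coord s x))"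
  proof (rule continuous_map_circle_point[OF e(2)])
    have "inner_coord s x \<in> {-1..1}" if "x \<in> sector e" for x
      using that inner_coord_bounds(2)[of "fst x" "snd x" s] e
      by (cases x) (auto simp: sector_iff abs_le_iff)
    moreover have "continuous_on (sector e) (inner_coord s)"
      unfolding inner_coord_def case_prod_unfold by (intro continuous_intros)
    ultimately show "continuous_map (top_of_set (sector e)) (top_of_set {-1..1}) (inner_coord s)"
      by auto
  qed
  moreover have "continuous_map (top_of_set (sector e)) (bouquet k) (\<lambda>x. circle_point k j (snd x))"
    by (rule continuous_map_circle_point[OF e(3)])
       (auto simp: e(1) sector_def intro!: continuous_intros)
  ultimately have "continuous_map (top_of_set (sector e)) (prod_topology (bouquet k) (bouquet k))
      (\<lambda>x. (circle_point k i (inner_coord s x), circle_point k j (snd x)))"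
    by (simp add: continuous_map_paired)
  moreover have "(circle_point k i (inner_coord s x), circle_point k j (snd x)) \<in> topspace (ordered_conf2 (bouquet k))"
    if "x \<in> sector e" for x
    using sector_pair_in[of i j s k "fst x" "snd x"] assms that e(1) by simp
  ultimately have "continuous_map (top_of_set (sector e)) (ordered_conf2 (bouquet k))
      (\<lambda>x. (circle_point k i (inner_coord s x), circle_point k j (snd x)))"
    unfolding ordered_conf2_def by (auto simp: continuous_map_in_subtopology)
  from continuous_map_compose[OF this quotient_imp_continuous_map[OF quotient_map_upair]]
  show ?thesis
    by (simp add: o_def sector_point_def e(1))
qed

text \<open>Besides equality, the cases are: the inner point is the base point; both points are the
  midpoints of different circles; the points are equally far from the base point and change roles.\<close>

lemma sector_point_eq_cases:
  assumes e: "(i, j, s) \<in> sectors k" "(i', j', s') \<in> sectors k"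
    and x: "(\<rho>, v) \<in> sector (i, j, s)" "(\<rho>', v') \<in> sector (i', j', s')"
    and eq: "sector_point k ((i, j, s), \<rho>, v) = sector_point k ((i', j', s'), \<rho>', v')"
  obtains "j' = j" "v' = v" "\<rho> = 0" "\<rho>' = 0"
    | "i' = i" "j' = j" "s' = s" "\<rho>' = \<rho>" "v' = v"
    | "i' = i" "j' = j" "i \<noteq> j" "\<rho> = 1" "\<rho>' = 1" "v = 0" "v' = 0"
    | "i' = j" "j' = i" "\<rho> = 1" "\<rho>' = 1" "v' = s * \<bar>v\<bar>" "v = s' * \<bar>v'\<bar>"
proof -
  have *: "0 \<le> \<rho>" "\<rho> \<le> 1" "\<bar>v\<bar> < 1" "i = j \<and> \<rho> = 1 \<Longrightarrow> s * v < 0" and k: "i < k" "j < k" "s \<in> {-1, 1}"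
    using e x by (auto simp: sector_iff sectors_def)
  have B: "0 \<le> \<rho>'" "\<rho>' \<le> 1" "\<bar>v'\<bar> < 1" and k': "i' < k" "j' < k" "s' \<in> {-1, 1}"
    using e x by (auto simp: sector_iff sectors_def)
  note b = inner_coord_bounds[OF *(1-3) k(3)] and b' = inner_coord_bounds[OF B(1-3) k'(3)]
  let ?u = "inner_coord s (\<rho>, v)" and ?u' = "inner_coord s' (\<rho>', v')"
  from eq have "circle_point k i ?u = circle_point k i' ?u' \<and> circle_point k j v = circle_point k j' v' \<or>
      circle_point k i ?u = circle_point k j' v' \<and> circle_point k j v = circle_point k i' ?u'"
    unfolding sector_point_def using sector_pair_in[OF e(1) x(1)] sector_pair_in[OF e(2) x(2)]
    by (simp add: upair_eq_iff)
  then consider (same) "i = i' \<and> ?u = ?u' \<or> \<bar>?u\<bar> = 1 \<and> \<bar>?u'\<bar> = 1" "j = j'" "v = v'"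
    | (swapped) "i = j'" "?u = v'" "j = i'" "v = ?u'"
    using b(2) b'(2) * B k k' by (auto simp: circle_point_eq_iff)
  then show thesis
  proof cases
    case same
    show thesis
    proof (cases "\<rho> = 0")
      case True
      then have "\<bar>?u'\<bar> = 1"
        using same(1) b(3) by auto
      then have "\<rho>' = 0"
        using b'(3) by simp
      with True same show thesis
        by (intro that(1)) simp_all
    next
      case False
      then have i: "i = i'" "?u = ?u'"
        using same(1) b(3) by auto
      have "\<rho> * (1 - \<bar>v\<bar>) = 1 - \<bar>?u\<bar>"
        by (rule b(1)[symmetric])
      also have "\<dots> = 1 - \<bar>?u'\<bar>"
        by (simp only: i(2))
      also have "\<dots> = \<rho>' * (1 - \<bar>v\<bar>)"
        unfolding b'(1) same(3) ..
      finally have "\<rho> * (1 - \<bar>v\<bar>) = \<rho>' * (1 - \<bar>v\<bar>)" .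
      then have \<rho>: "\<rho> = \<rho>'"
        using *(3) by (simp only: mult_cancel_right) auto
      \<comment> \<open>Equal inner coordinates with different signs mean that the inner point is
        the middle of its circle, where both halves meet. Its distance 1 is maximal, so the outer
        point is a midpoint too and the ratio is 1.\<close>
      then have "(s - s') * (1 - \<rho> * (1 - \<bar>v\<bar>)) = 0"
        using i(2) same(3) by (simp add: inner_coord_def algebra_simps)
      then consider "s = s'" | "\<rho> * (1 - \<bar>v\<bar>) = 1" by auto
      then show thesis
      proof cases
        case 1
        then show thesis
          using i \<rho> same by (intro that(2)) simp_all
      next
        case 2
        have "\<rho> * (1 - \<bar>v\<bar>) \<le> 1 * (1 - \<bar>v\<bar>)"
          using * by (intro mult_right_mono) auto
        with 2 have v: "v = 0" by simp
        with 2 have "\<rho> = 1" by simp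
        with v * i \<rho> same show thesis
          by (intro that(3)) auto
      qed
    qed
  next
    case swapped
    \<comment> \<open>When the roles are exchanged, each distance is the other one times a ratio of
      at most 1. Both distances therefore agree and both ratios are 1.\<close>
    have squeeze: "A = y \<and> B = x" if "x = A" "y = B" "A \<le> y" "B \<le> x" for A B x y :: real
      using that by linarith
    have "\<rho> * (1 - \<bar>v\<bar>) = 1 - \<bar>v\<bar> \<and> \<rho>' * (1 - \<bar>v'\<bar>) = 1 - \<bar>v'\<bar>"
    proof (rule squeeze)
      show "1 - \<bar>v'\<bar> = \<rho> * (1 - \<bar>v\<bar>)" "1 - \<bar>v\<bar> = \<rho>' * (1 - \<bar>v'\<bar>)"
        using b(1) b'(1) unfolding swapped(2) swapped(4)[symmetric] by simp_all
      show "\<rho> * (1 - \<bar>v\<bar>) \<le> 1 - \<bar>v\<bar>" "\<rho>' * (1 - \<bar>v'\<bar>) \<le> 1 - \<bar>v'\<bar>"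
        using * B by (auto intro!: mult_left_le_one_le)
    qed
    then have \<rho>: "\<rho> = 1" "\<rho>' = 1"
      using *(3) B(3) unfolding mult_cancel_right2 by auto
    have "?u = s * \<bar>v\<bar>" "?u' = s' * \<bar>v'\<bar>"
      by (simp_all add: inner_coord_def \<rho>)
    then have "v' = s * \<bar>v\<bar>" "v = s' * \<bar>v'\<bar>"
      unfolding swapped(2) swapped(4)[symmetric] .
    with \<rho> swapped(1,3) show thesis
      by (intro that(4)) (rule refl | assumption | erule sym)+
  qed
qed

lemma continuous_map_discrete_Times:
  fixes I :: "'a::discrete_topology set"
  assumes "\<And>i. i \<in> I \<Longrightarrow> continuous_map (top_of_set T) Z (\<lambda>u. f (i, u))"
  shows "continuous_map (top_of_set (I \<times> T)) Z f"
  unfolding continuous_map_def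
proof (intro conjI allI impI)
  show "f \<in> topspace (top_of_set (I \<times> T)) \<rightarrow> topspace Z"
    using continuous_map_funspace[OF assms] by (fastforce simp: Pi_iff)
next
  fix U assume U: "openin Z U"
  have "openin (top_of_set (I \<times> T)) ({i} \<times> {u \<in> topspace (top_of_set T). f (i, u) \<in> U})" if "i \<in> I" for i
    using openin_continuous_map_preimage[OF assms[OF that] U] that
    by (intro openin_Times) (auto simp: open_discrete open_subset)
  then have "openin (top_of_set (I \<times> T)) (\<Union>i\<in>I. {i} \<times> {u \<in> topspace (top_of_set T). f (i, u) \<in> U})"
    by blast
  moreover have "(\<Union>i\<in>I. {i} \<times> {u \<in> topspace (top_of_set T). f (i, u) \<in> U}) =
      {x \<in> topspace (top_of_set (I \<times> T)). f x \<in> U}"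
    by auto
  ultimately show "openin (top_of_set (I \<times> T)) {x \<in> topspace (top_of_set (I \<times> T)). f x \<in> U}"
    by simp
qed

section \<open>Presentation of the configuration space by sectors\<close>

definition distinct_coords :: "nat \<Rightarrow> ((nat \<times> real) \<times> nat \<times> real) set" where
  "distinct_coords k = {((i, u), (j, v)). i < k \<and> j < k \<and> \<bar>u\<bar> \<le> 1 \<and> \<bar>v\<bar> \<le> 1 \<and>
                          circle_point k i u \<noteq> circle_point k j v}"

text \<open>All pairs of coordinates form a compact space and the square of the bouquet is
  Hausdorff, so the parametrisation is a closed map. A closed map stays closed when restricted to a
  full preimage, here that of the complement of the diagonal; this replaces compactness of the
  configuration space.\<close>

lemma quotient_map_distinct_coords:
  "quotient_map (top_of_set (distinct_coords k)) (unordered_conf2 (bouquet k))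
     (\<lambda>((i, u), (j, v)). upair k (circle_point k i u) (circle_point k j v))"
proof -
  let ?S = "{..<k} \<times> {-1..1::real}"
  let ?b = "\<lambda>(i, u). circle_point k i u"
  let ?bb = "\<lambda>(x, y). (?b x, ?b y)"
  let ?XX = "prod_topology (bouquet k) (bouquet k)"
  have b: "continuous_map (top_of_set ?S) (bouquet k) ?b"
    by (rule continuous_map_discrete_Times) (auto intro!: continuous_map_circle_point)
  let ?SS = "prod_topology (top_of_set ?S) (top_of_set ?S)"
  have 1: "continuous_map ?SS (bouquet k) (\<lambda>x. ?b (fst x))"
    by (rule continuous_map_compose[OF continuous_map_fst b, unfolded o_def])
  have 2: "continuous_map ?SS (bouquet k) (\<lambda>x. ?b (snd x))"
    by (rule continuous_map_compose[OF continuous_map_snd b, unfolded o_def])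
  have "continuous_map ?SS ?XX ?bb"
    using continuous_map_paired[THEN iffD2, OF conjI[OF 1 2]] by (simp only: case_prod_unfold)
  then have bb: "continuous_map (top_of_set (?S \<times> ?S)) ?XX ?bb"
    by (simp only: prod_top_of_set)
  have "compact_space (top_of_set (?S \<times> ?S))"
    by (intro compact_space_subtopology) (simp add: compact_Times finite_imp_compact)
  moreover have "Hausdorff_space ?XX"
    by (simp add: Hausdorff_space_prod_topology Hausdorff_space_bouquet)
  ultimately have "closed_map (top_of_set (?S \<times> ?S)) ?XX ?bb"
    using bb by (intro T1_Spaces.continuous_imp_closed_map)
  moreover have dc: "{x \<in> topspace (top_of_set (?S \<times> ?S)). ?bb x \<in> {(x, y). x \<noteq> y}} = distinct_coords k"
    by (auto simp: distinct_coords_def abs_le_iff)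
  ultimately have "closed_map (subtopology (top_of_set (?S \<times> ?S)) (distinct_coords k)) (ordered_conf2 (bouquet k)) ?bb"
    unfolding ordered_conf2_def by (rule closed_map_restriction)
  moreover have sub: "subtopology (top_of_set (?S \<times> ?S)) (distinct_coords k) = top_of_set (distinct_coords k)"
    using dc by (auto simp: subtopology_subtopology intro!: arg_cong[where f = "subtopology euclidean"])
  moreover have "continuous_map (top_of_set (distinct_coords k)) (ordered_conf2 (bouquet k)) ?bb"
    using continuous_map_from_subtopology[OF bb, of "distinct_coords k"] dc
    unfolding sub ordered_conf2_def
    by (intro continuous_map_into_subtopology) (auto simp: distinct_coords_def)
  moreover have "?bb ` topspace (top_of_set (distinct_coords k)) = topspace (ordered_conf2 (bouquet k))"
  proof (intro equalityI subsetI)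
    fix z assume "z \<in> ?bb ` topspace (top_of_set (distinct_coords k))"
    then show "z \<in> topspace (ordered_conf2 (bouquet k))"
      by (auto simp: distinct_coords_def topspace_ordered_conf2 circle_point_in)
  next
    fix z assume "z \<in> topspace (ordered_conf2 (bouquet k))"
    then obtain P Q where "z = (P, Q)" "P \<in> topspace (bouquet k)" "Q \<in> topspace (bouquet k)" "P \<noteq> Q"
      by (auto simp: topspace_ordered_conf2)
    moreover obtain i u where "P = circle_point k i u" "i < k" "u \<in> {-1..1}"
      using \<open>P \<in> topspace (bouquet k)\<close> by (rule topspace_bouquetE)
    moreover obtain j v where "Q = circle_point k j v" "j < k" "v \<in> {-1..1}"
      using \<open>Q \<in> topspace (bouquet k)\<close> by (rule topspace_bouquetE)
    ultimately have "z = ?bb ((i, u), (j, v))" "((i, u), (j, v)) \<in> topspace (top_of_set (distinct_coords k))"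
      by (simp_all add: distinct_coords_def abs_le_iff)
    then show "z \<in> ?bb ` topspace (top_of_set (distinct_coords k))"
      by (rule image_eqI)
  qed
  ultimately have "quotient_map (top_of_set (distinct_coords k)) (ordered_conf2 (bouquet k)) ?bb"
    by (simp add: continuous_closed_imp_quotient_map)
  from quotient_map_compose[OF this quotient_map_upair] show ?thesis
    by (simp add: o_def case_prod_unfold)
qed

definition sector_coords :: "(nat \<times> real) \<times> nat \<times> real \<Rightarrow> real \<times> real" where
  "sector_coords = (\<lambda>((i, u), (j, v)). ((1 - \<bar>u\<bar>) / (1 - \<bar>v\<bar>), v))"

lemma sector_coords:
  assumes w: "((i, u), (j, v)) \<in> distinct_coords k" and s: "s \<in> {-1, 1}" "s * u = \<bar>u\<bar>" and le: "\<bar>v\<bar> \<le> \<bar>u\<bar>"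
  shows "(i, j, s) \<in> sectors k" "\<bar>v\<bar> < 1" "sector_coords ((i, u), (j, v)) \<in> sector (i, j, s)"
    "inner_coord s (sector_coords ((i, u), (j, v))) = u"
proof -
  have *: "i < k" "j < k" "\<bar>u\<bar> \<le> 1" "\<bar>v\<bar> \<le> 1" "circle_point k i u \<noteq> circle_point k j v"
    using w by (auto simp: distinct_coords_def)
  then have neq: "\<not> (i = j \<and> u = v)" "\<not> (\<bar>u\<bar> = 1 \<and> \<bar>v\<bar> = 1)"
    by (auto simp: circle_point_eq_iff)
  show v: "\<bar>v\<bar> < 1"
    using neq(2) * le by linarith
  show "(i, j, s) \<in> sectors k"
    using * s by (auto simp: sectors_def)
  define \<rho> where "\<rho> = (1 - \<bar>u\<bar>) / (1 - \<bar>v\<bar>)"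
  have \<rho>: "0 \<le> \<rho>" "\<rho> \<le> 1" "\<rho> * (1 - \<bar>v\<bar>) = 1 - \<bar>u\<bar>"
    using v le * by (auto simp: \<rho>_def)
  have "s * v < 0" if "i = j" "\<rho> = 1"
  proof -
    have "\<bar>u\<bar> = \<bar>v\<bar>" "u \<noteq> v"
      using \<rho>(3) that neq(1) by auto
    then have "u = - v" "v \<noteq> 0" by auto
    with s show ?thesis by auto
  qed
  then show "sector_coords ((i, u), (j, v)) \<in> sector (i, j, s)"
    using \<rho> v by (simp add: sector_coords_def sector_iff \<rho>_def[symmetric])
  show "inner_coord s (sector_coords ((i, u), (j, v))) = u"
    using s \<rho>(3) by (auto simp: sector_coords_def inner_coord_def \<rho>_def[symmetric])
qed

text \<open>The pieces \<open>C e\<close> and their swaps form a finite closed cover of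
  \<open>distinct_coords k\<close>, and \<open>sector_coords\<close> maps \<open>C e\<close>
  continuously into its sector. A set with closed preimage in the sectors thus has closed preimage
  in \<open>distinct_coords k\<close>, whose quotient map is already known.\<close>

lemma quotient_map_sector_point:
  "quotient_map (sector_space k) (unordered_conf2 (bouquet k)) (sector_point k)"
proof -
  let ?B = "unordered_conf2 (bouquet k)"
  define \<Psi> where "\<Psi> = (\<lambda>((i, u), (j, v)). upair k (circle_point k i u) (circle_point k j v))"
  have quot: "quotient_map (top_of_set (distinct_coords k)) ?B \<Psi>"
    unfolding \<Psi>_def by (rule quotient_map_distinct_coords)
  have top: "topspace (sector_space k) = Sigma (sectors k) sector"
    by (auto simp: sector_space_def)
  have cont: "continuous_map (sector_space k) ?B (sector_point k)"
    unfolding sector_space_def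
    by (rule continuous_map_from_sum_topology) (rule continuous_map_sector_point)
  have swap: "prod.swap w \<in> distinct_coords k" "\<Psi> (prod.swap w) = \<Psi> w" if "w \<in> distinct_coords k" for w
    using that by (auto simp: \<Psi>_def distinct_coords_def topspace_ordered_conf2 circle_point_in intro!: upair_commute)
  \<comment> \<open>The first point is the inner one, since a larger absolute coordinate means a
    smaller distance to the base point; the other order is reached by swapping. Non-strict
    conditions keep the pieces closed: ties lie in both orders, and the coordinate 0 belongs to both
    signs.\<close>
  define C where "C = (\<lambda>(i, j, s). {w \<in> distinct_coords k. fst (fst w) = i \<and> fst (snd w) = j \<and>
      s * snd (fst w) = \<bar>snd (fst w)\<bar> \<and> \<bar>snd (snd w)\<bar> \<le> \<bar>snd (fst w)\<bar>})"
  have C: "sector_coords w \<in> sector e" "sector_point k (e, sector_coords w) = \<Psi> w" "\<bar>snd (snd w)\<bar> < 1"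
    if ew: "e \<in> sectors k" "w \<in> C e" for e w
  proof -
    obtain i j s where e: "e = (i, j, s)" "i < k" "j < k" "s \<in> {-1, 1}"
      using ew(1) by (rule sectorsE)
    obtain i' u j' v where w': "w = ((i', u), (j', v))"
      by (metis surj_pair)
    then have w: "w = ((i, u), (j, v))"
      using that(2) by (simp add: C_def e(1))
    have "((i, u), (j, v)) \<in> distinct_coords k" "s * u = \<bar>u\<bar>" "\<bar>v\<bar> \<le> \<bar>u\<bar>"
      using that(2) by (simp_all add: C_def e(1) w)
    note sc = sector_coords[OF this(1) e(4) this(2,3)]
    show "sector_coords w \<in> sector e" "\<bar>snd (snd w)\<bar> < 1"
      using sc(2,3) by (simp_all add: e(1) w)
    show "sector_point k (e, sector_coords w) = \<Psi> w"
      using sc(4) by (simp add: \<Psi>_def e(1) w sector_point_def sector_coords_def)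
  qed
  have cover: "\<exists>e\<in>sectors k. w \<in> C e \<or> prod.swap w \<in> C e" if "w \<in> distinct_coords k" for w
  proof -
    obtain i u j v where w: "w = ((i, u), (j, v))"
      by (metis surj_pair)
    let ?sg = "\<lambda>x::real. if 0 \<le> x then 1 else -1"
    have ij: "i < k" "j < k"
      using that by (auto simp: w distinct_coords_def)
    show ?thesis
    proof (cases "\<bar>v\<bar> \<le> \<bar>u\<bar>")
      case True
      then have "w \<in> C (i, j, ?sg u)"
        using that by (simp add: C_def w)
      then show ?thesis
        using ij by (intro bexI[of _ "(i, j, ?sg u)"]) (auto simp: sectors_def)
    next
      case False
      then have "prod.swap w \<in> C (j, i, ?sg v)"
        using swap(1)[OF that] by (simp add: C_def w)
      then show ?thesis
        using ij by (intro bexI[of _ "(j, i, ?sg v)"]) (auto simp: sectors_def)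
    qed
  qed
  have closed_C: "closedin (top_of_set (distinct_coords k)) (C e)" if "e \<in> sectors k" for e
  proof -
    obtain i j s where e: "e = (i, j, s)"
      by (metis surj_pair)
    let ?c = "{w. fst (fst w) = i \<and> fst (snd w) = j \<and>
      s * snd (fst w) = \<bar>snd (fst w)\<bar> \<and> \<bar>snd (snd w)\<bar> \<le> \<bar>snd (fst w)\<bar>} :: ((nat \<times> real) \<times> nat \<times> real) set"
    have "closed ?c"
      by (intro closed_Collect_conj closed_Collect_eq closed_Collect_le continuous_intros)
    moreover have "C e = distinct_coords k \<inter> ?c"
      by (auto simp: C_def e)
    ultimately show ?thesis
      by (simp add: closedin_closed_Int)
  qed
  show ?thesis
    unfolding quotient_map_closedin
  proof (intro conjI allI impI)
    show "sector_point k ` topspace (sector_space k) = topspace ?B"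
    proof (intro equalityI subsetI)
      fix z assume "z \<in> sector_point k ` topspace (sector_space k)"
      then show "z \<in> topspace ?B"
        using continuous_map_image_subset_topspace[OF cont] by blast
    next
      fix z assume "z \<in> topspace ?B"
      then have "z \<in> \<Psi> ` distinct_coords k"
        using quotient_imp_surjective_map[OF quot] by simp
      then obtain w where w: "z = \<Psi> w" "w \<in> distinct_coords k"
        by (rule imageE)
      from cover[OF w(2)] obtain e w' where e: "e \<in> sectors k" "w' \<in> C e" and w': "w' = w \<or> w' = prod.swap w"
        by blast
      from w' have "z = \<Psi> w'"
        using w(1) swap(2)[OF w(2)] by (elim disjE) simp_all
      then have "z = sector_point k (e, sector_coords w')"
        using C(2)[OF e(1,2)] by simp
      moreover have "(e, sector_coords w') \<in> topspace (sector_space k)"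
        using C(1)[OF e(1,2)] e(1) by (simp add: top)
      ultimately show "z \<in> sector_point k ` topspace (sector_space k)"
        by (rule image_eqI)
    qed
  next
    fix U assume U: "U \<subseteq> topspace ?B"
    show "closedin (sector_space k) {x \<in> topspace (sector_space k). sector_point k x \<in> U} \<longleftrightarrow> closedin ?B U"
    proof
      assume "closedin ?B U"
      then show "closedin (sector_space k) {x \<in> topspace (sector_space k). sector_point k x \<in> U}"
        by (rule closedin_continuous_map_preimage[OF cont])
    next
      define W where "W = {x \<in> topspace (sector_space k). sector_point k x \<in> U}"
      assume "closedin (sector_space k) {x \<in> topspace (sector_space k). sector_point k x \<in> U}"
      then have L: "closedin (sector_space k) W"
        by (simp only: W_def)
      let ?A = "\<lambda>e. {w \<in> C e. \<Psi> w \<in> U}"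
      have A: "closedin (top_of_set (distinct_coords k)) (?A e)" if e: "e \<in> sectors k" for e
      proof -
        have "{x. (e, x) \<in> W} = {x \<in> sector e. sector_point k (e, x) \<in> U}"
          using e by (auto simp: W_def top)
        moreover have "closedin (top_of_set (sector e)) {x. (e, x) \<in> W}"
          using L e unfolding sector_space_def closedin_sum_topology by blast
        ultimately have "closedin (top_of_set (sector e)) {x \<in> sector e. sector_point k (e, x) \<in> U}"
          by simp
        moreover have "continuous_map (top_of_set (C e)) (top_of_set (sector e)) sector_coords"
        proof -
          have "continuous_on (C e) sector_coords"
            unfolding sector_coords_def case_prod_unfold
            by (intro continuous_intros) (use C(3)[OF e] in fastforce)
          then show ?thesis
            using C(1)[OF e] by (intro continuous_map_into_subtopology) (simp_all add: Pi_iff)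
        qed
        ultimately have "closedin (top_of_set (C e))
            {w \<in> topspace (top_of_set (C e)). sector_coords w \<in> {x \<in> sector e. sector_point k (e, x) \<in> U}}"
          by (rule closedin_continuous_map_preimage[rotated])
        moreover have "{w \<in> topspace (top_of_set (C e)). sector_coords w \<in> {x \<in> sector e. sector_point k (e, x) \<in> U}} = ?A e"
        proof (intro equalityI subsetI)
          fix w assume "w \<in> {w \<in> topspace (top_of_set (C e)). sector_coords w \<in> {x \<in> sector e. sector_point k (e, x) \<in> U}}"
          then show "w \<in> ?A e"
            using C(2)[OF e, of w] by simp
        next
          fix w assume "w \<in> ?A e"
          then show "w \<in> {w \<in> topspace (top_of_set (C e)). sector_coords w \<in> {x \<in> sector e. sector_point k (e, x) \<in> U}}"
            using C(1,2)[OF e, of w] by simp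
        qed
        ultimately have "closedin (top_of_set (C e)) (?A e)"
          by (simp only:)
        then show ?thesis
          by (rule closedin_trans[OF _ closed_C[OF e]])
      qed
      have sw: "continuous_map (top_of_set (distinct_coords k)) (top_of_set (distinct_coords k)) prod.swap"
        using swap(1) by (auto simp: prod.swap_def intro!: continuous_intros)
      have "closedin (top_of_set (distinct_coords k))
          (\<Union>e\<in>sectors k. ?A e \<union> {w \<in> topspace (top_of_set (distinct_coords k)). prod.swap w \<in> ?A e})"
      proof (rule closedin_Union)
        show "finite ((\<lambda>e. ?A e \<union> {w \<in> topspace (top_of_set (distinct_coords k)). prod.swap w \<in> ?A e}) ` sectors k)"
          by (simp add: sectors_def)
        fix T assume "T \<in> (\<lambda>e. ?A e \<union> {w \<in> topspace (top_of_set (distinct_coords k)). prod.swap w \<in> ?A e}) ` sectors k"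
        then obtain e where "T = ?A e \<union> {w \<in> topspace (top_of_set (distinct_coords k)). prod.swap w \<in> ?A e}" "e \<in> sectors k"
          by (rule imageE)
        then show "closedin (top_of_set (distinct_coords k)) T"
          by (simp only: closedin_Un A closedin_continuous_map_preimage[OF sw])
      qed
      moreover have "(\<Union>e\<in>sectors k. ?A e \<union> {w \<in> topspace (top_of_set (distinct_coords k)). prod.swap w \<in> ?A e}) =
          {w \<in> topspace (top_of_set (distinct_coords k)). \<Psi> w \<in> U}"
      proof (intro equalityI subsetI)
        fix w assume "w \<in> (\<Union>e\<in>sectors k. ?A e \<union> {w \<in> topspace (top_of_set (distinct_coords k)). prod.swap w \<in> ?A e})"
        then consider e where "w \<in> C e" "\<Psi> w \<in> U" | "w \<in> distinct_coords k" "\<Psi> (prod.swap w) \<in> U"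
          by auto
        then show "w \<in> {w \<in> topspace (top_of_set (distinct_coords k)). \<Psi> w \<in> U}"
        proof cases
          case (1 e)
          then show ?thesis by (auto simp: C_def)
        next
          case 2
          then show ?thesis using swap(2)[of w] by simp
        qed
      next
        fix w assume w: "w \<in> {w \<in> topspace (top_of_set (distinct_coords k)). \<Psi> w \<in> U}"
        then have wd: "w \<in> distinct_coords k" "\<Psi> w \<in> U"
          by simp_all
        from cover[OF wd(1)] obtain e where "e \<in> sectors k" "w \<in> C e \<or> prod.swap w \<in> C e"
          by blast
        with wd show "w \<in> (\<Union>e\<in>sectors k. ?A e \<union> {w \<in> topspace (top_of_set (distinct_coords k)). prod.swap w \<in> ?A e})"
          using swap(2)[OF wd(1)] by auto
      qed
      ultimately have "closedin (top_of_set (distinct_coords k))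
          {w \<in> topspace (top_of_set (distinct_coords k)). \<Psi> w \<in> U}"
        by simp
      then show "closedin ?B U"
        using quot U unfolding quotient_map_closedin by blast
    qed
  qed
qed

section \<open>Retraction onto a graph\<close>

text \<open>At ratio 1 the sign \<open>s\<close> is forgotten along with the roles. For
  \<open>i \<noteq> j\<close> the two halves meet when both points are midpoints; for
  \<open>i = j\<close> changing the sign amounts to exchanging the roles.\<close>

definition sector_label :: "(nat \<times> nat \<times> real) \<times> real \<Rightarrow> nat + nat set" where
  "sector_label = (\<lambda>((i, j, s), t). if t = 0 then Inl j else Inr {i, j})"

text \<open>The outer point is moved to the middle of its circle, unless the inner point lies on the
  same circle and might be hit; then it is moved to the other half.\<close>

definition rest_coord :: "nat \<times> nat \<times> real \<Rightarrow> real \<Rightarrow> real" where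
  "rest_coord = (\<lambda>(i, j, s) \<rho>. if i = j then - s * \<rho> / 2 else 0)"

definition slide :: "nat \<times> nat \<times> real \<Rightarrow> real \<Rightarrow> real \<times> real \<Rightarrow> real \<times> real" where
  "slide e t = (\<lambda>(\<rho>, v). (\<rho>, (1 - t) * v + t * rest_coord e \<rho>))"

abbreviation sector_graph_point :: "nat \<Rightarrow> (nat \<times> nat \<times> real) \<times> real \<Rightarrow> _" where
  "sector_graph_point k \<equiv> graph_point (sectors k) sector_label"

lemma finite_sectors: "finite (sectors k)"
  by (simp add: sectors_def)

text \<open>For a fixed ratio the admissible outer coordinates form an interval that contains the
  rest coordinate, so the segment between the two stays inside.\<close>

lemma slide_in_sector:
  assumes e: "e \<in> sectors k" and x: "x \<in> sector e" and t: "t \<in> {0..1}"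
  shows "slide e t x \<in> sector e"
proof -
  obtain i j s where ijs: "e = (i, j, s)" "i < k" "j < k" "s \<in> {-1, 1}"
    using e by (rule sectorsE)
  obtain \<rho> v where xeq: "x = (\<rho>, v)"
    by (rule prod.exhaust)
  let ?r = "rest_coord e \<rho>"
  have *: "0 \<le> \<rho>" "\<rho> \<le> 1" "\<bar>v\<bar> < 1" and opp: "i = j \<Longrightarrow> \<rho> = 1 \<Longrightarrow> s * v < 0"
    using x by (auto simp: ijs(1) xeq sector_iff)
  have r: "\<bar>?r\<bar> < 1"
    using * ijs(4) by (auto simp: rest_coord_def ijs(1))
  have "\<bar>(1 - t) * v + t * ?r\<bar> < 1"
  proof -
    have "\<bar>(1 - t) * v + t * ?r\<bar> \<le> (1 - t) * \<bar>v\<bar> + t * \<bar>?r\<bar>"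
      using t abs_triangle_ineq[of "(1 - t) * v" "t * ?r"] by (simp add: abs_mult)
    also have "\<dots> < 1"
      using convex_bound_lt[of "\<bar>v\<bar>" 1 "\<bar>?r\<bar>" "1 - t" t] *(3) r t by simp
    finally show ?thesis .
  qed
  moreover have "s * ((1 - t) * v + t * ?r) < 0" if "i = j" "\<rho> = 1"
  proof -
    have "s * ((1 - t) * v + t * ?r) = (1 - t) * (s * v) + t * (-1 / 2)"
      using ijs(4) that by (auto simp: rest_coord_def ijs(1))
    also have "\<dots> < 0"
      using convex_bound_lt[of "s * v" 0 "-1 / 2" "1 - t" t] opp[OF that] t by simp
    finally show ?thesis .
  qed
  ultimately show ?thesis
    using *(1,2) by (simp add: slide_def xeq ijs(1) sector_iff)
qed

lemma rest_in_sector: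
  assumes "e \<in> sectors k" "\<rho> \<in> {0..1}"
  shows "(\<rho>, rest_coord e \<rho>) \<in> sector e"
  using assms(1)
proof (rule sectorsE)
  fix i j s assume e: "e = (i, j, s)" "s \<in> {-1, 1}"
  then show ?thesis
    using assms(2) by (auto simp: sector_iff rest_coord_def)
qed

lemma slide_1: "slide e 1 (\<rho>, v) = (\<rho>, rest_coord e \<rho>)"
  by (simp add: slide_def)

text \<open>At equal distances a pair lies in two sectors with the roles exchanged, and the inner
  point dragged along in one must follow the outer point of the other. On different circles both
  coordinates are scaled by \<open>1 - t\<close>; on one circle they remain opposite, with absolute
  value \<open>(1 - t) * \<bar>v\<bar> + t / 2\<close>.\<close>

lemma slide_opposite:
  assumes s: "s \<in> {-1, 1}" "s' \<in> {-1, 1}" and v: "v' = s * \<bar>v\<bar>" "v = s' * \<bar>v'\<bar>"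
    and x: "(1, v) \<in> sector (i, j, s)" and t: "t \<in> {0..1}"
  shows "inner_coord s (slide (i, j, s) t (1, v)) = snd (slide (j, i, s') t (1, v'))"
proof (cases "i = j")
  case False
  have "\<bar>(1 - t) * v\<bar> = (1 - t) * \<bar>v\<bar>"
    using t by (simp add: abs_mult)
  then show ?thesis
    using False v(1) by (simp add: inner_coord_def slide_def rest_coord_def)
next
  case True
  have sv: "s * v < 0"
    using x True by (simp add: sector_iff)
  then have v_eq: "v = - s * \<bar>v\<bar>"
    using s(1) by auto
  have abs_v': "\<bar>v'\<bar> = \<bar>v\<bar>"
    unfolding v(1) using s(1) by auto
  \<comment> \<open>Distinct points of one circle at equal distances lie on opposite halves, so
    exchanging the roles changes the sign.\<close>
  have s': "s' = - s"
  proof (rule ccontr)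
    assume "s' \<noteq> - s"
    then have "s' = s"
      using s by auto
    then have "v = s * \<bar>v\<bar>"
      using v(2) unfolding abs_v' by simp
    then have "s * v = s * (s * \<bar>v\<bar>)"
      by (rule arg_cong)
    also have "\<dots> = \<bar>v\<bar>"
      using s(1) by auto
    finally show False
      using sv by simp
  qed
  have "(1 - t) * v + t * (- s / 2) = - s * ((1 - t) * \<bar>v\<bar> + t / 2)"
    by (subst (1) v_eq) (simp add: algebra_simps)
  moreover have "0 \<le> (1 - t) * \<bar>v\<bar> + t / 2"
    using t by auto
  ultimately have "\<bar>(1 - t) * v + t * (- s / 2)\<bar> = \<bar>s\<bar> * ((1 - t) * \<bar>v\<bar> + t / 2)"
    by (simp add: abs_mult)
  then have abs_slide: "\<bar>(1 - t) * v + t * (- s / 2)\<bar> = (1 - t) * \<bar>v\<bar> + t / 2"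
    using s(1) by auto
  have "inner_coord s (slide (i, j, s) t (1, v)) = s * \<bar>(1 - t) * v + t * (- s / 2)\<bar>"
    using True by (simp add: inner_coord_def slide_def rest_coord_def)
  also have "\<dots> = (1 - t) * (s * \<bar>v\<bar>) + t * (s / 2)"
    unfolding abs_slide by (simp add: algebra_simps)
  also have "\<dots> = snd (slide (j, i, s') t (1, v'))"
    unfolding v(1) s' using True by (simp add: slide_def rest_coord_def)
  finally show ?thesis .
qed

text \<open>At ratio 0 the inner coordinate is \<open>s\<close>, an end of the parameter interval,
  hence the base point for every circle and every half.\<close>

lemma sector_point_base:
  assumes "(i, j, s) \<in> sectors k" "(i', j, s') \<in> sectors k"
  shows "sector_point k ((i, j, s), 0, v) = sector_point k ((i', j, s'), 0, v)"
proof -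
  have "circle_point k i s = circle_point k i' s'"
    using assms by (subst circle_point_eq_iff) (auto simp: sectors_def)
  then show ?thesis
    by (simp add: sector_point_def inner_coord_def)
qed

lemma sector_point_opposite:
  assumes "(i, j, s) \<in> sectors k" "x \<in> sector (i, j, s)"
    and "inner_coord s x = snd x'" "inner_coord s' x' = snd x"
  shows "sector_point k ((i, j, s), x) = sector_point k ((j, i, s'), x')"
  using upair_commute[OF sector_pair_in[of i j s k "fst x" "snd x"]] assms
  by (simp add: sector_point_def)

text \<open>This makes the ratio a well-defined map into the graph: an identification of pairs
  either fixes the sector and the ratio, or happens at ratio 0 or 1 between sectors with the same
  label.\<close>

lemma sector_graph_point_compat:
  assumes "(e, \<rho>, v) \<in> topspace (sector_space k)" "(e', \<rho>', v') \<in> topspace (sector_space k)"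
    and eq: "sector_point k (e, \<rho>, v) = sector_point k (e', \<rho>', v')"
  shows "sector_graph_point k (e, \<rho>) = sector_graph_point k (e', \<rho>')"
proof -
  have e: "e \<in> sectors k" "e' \<in> sectors k" and x: "(\<rho>, v) \<in> sector e" "(\<rho>', v') \<in> sector e'"
    using assms(1,2) by (auto simp: sector_space_def)
  obtain i j s i' j' s' where ee: "e = (i, j, s)" "e' = (i', j', s')"
    by (metis surj_pair)
  have "(e, \<rho>) = (e', \<rho>') \<or> \<rho> \<in> {0, 1} \<and> \<rho>' \<in> {0, 1} \<and> sector_label (e, \<rho>) = sector_label (e', \<rho>')"
    using e[unfolded ee] x[unfolded ee] eq[unfolded ee]
    by (rule sector_point_eq_cases) (auto simp: ee sector_label_def)
  then show ?thesis
    using e x by (subst graph_point_eq_iff) (auto simp: ee sector_iff)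
qed

lemma sector_point_slide_compat:
  assumes "(e, \<rho>, v) \<in> topspace (sector_space k)" "(e', \<rho>', v') \<in> topspace (sector_space k)"
    and eq: "sector_point k (e, \<rho>, v) = sector_point k (e', \<rho>', v')" and t: "t \<in> {0..1}"
  shows "sector_point k (e, slide e t (\<rho>, v)) = sector_point k (e', slide e' t (\<rho>', v'))"
proof -
  have e: "e \<in> sectors k" "e' \<in> sectors k" and x: "(\<rho>, v) \<in> sector e" "(\<rho>', v') \<in> sector e'"
    using assms(1,2) by (auto simp: sector_space_def)
  obtain i j s i' j' s' where ee: "e = (i, j, s)" "e' = (i', j', s')"
    by (metis surj_pair)
  have s: "s \<in> {-1, 1}" "s' \<in> {-1, 1}"
    using e unfolding ee by (auto simp: sectors_def)
  show ?thesis
    using e[unfolded ee] x[unfolded ee] eq[unfolded ee]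
  proof (rule sector_point_eq_cases)
    \<comment> \<open>The inner point is the base point, so the pair determines neither
      \<open>i\<close> nor \<open>s\<close>. The factor \<open>\<rho>\<close> in
      \<open>rest_coord\<close> makes the rest position 0 here, independent of both.\<close>
    assume *: "j' = j" "v' = v" "\<rho> = 0" "\<rho>' = 0"
    have "slide e t (\<rho>, v) = (0, (1 - t) * v)" "slide e' t (\<rho>', v') = (0, (1 - t) * v)"
      by (simp_all add: slide_def rest_coord_def ee *)
    then show ?thesis
      using sector_point_base[of i j s k i' s'] e by (simp add: ee *)
  next
    assume "i' = i" "j' = j" "s' = s" "\<rho>' = \<rho>" "v' = v"
    then show ?thesis by (simp add: ee)
  next
    \<comment> \<open>Both points are midpoints of different circles and the slide leaves them
      there, so the sign does not matter.\<close>
    assume "i' = i" "j' = j" "i \<noteq> j" "\<rho> = 1" "\<rho>' = 1" "v = 0" "v' = 0"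
    then show ?thesis
      by (simp add: ee slide_def rest_coord_def sector_point_def inner_coord_def)
  next
    assume *: "i' = j" "j' = i" "\<rho> = 1" "\<rho>' = 1" and v: "v' = s * \<bar>v\<bar>" "v = s' * \<bar>v'\<bar>"
    have x1: "(1, v) \<in> sector (i, j, s)" "(1, v') \<in> sector (j, i, s')"
      using x by (simp_all add: ee *)
    have "sector_point k ((i, j, s), slide (i, j, s) t (1, v)) = sector_point k ((j, i, s'), slide (j, i, s') t (1, v'))"
      using slide_in_sector[OF e(1) x(1) t] e(1)
        slide_opposite[OF s v x1(1) t] slide_opposite[OF s(2,1) v(2,1) x1(2) t]
      by (intro sector_point_opposite) (simp_all only: ee *)
    then show ?thesis
      by (simp only: ee *)
  qed
qed

text \<open>The rest positions define a map from the graph back to the configuration space: at a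
  vertex they depend only on the label.\<close>

lemma sector_point_rest_compat:
  assumes x: "x \<in> sectors k \<times> {0..1}" "y \<in> sectors k \<times> {0..1}"
    and eq: "sector_graph_point k x = sector_graph_point k y"
  shows "sector_point k (fst x, snd x, rest_coord (fst x) (snd x)) =
         sector_point k (fst y, snd y, rest_coord (fst y) (snd y))"
proof (cases "x = y")
  case False
  obtain i j s \<rho> i' j' s' \<rho>' where xy: "x = ((i, j, s), \<rho>)" "y = ((i', j', s'), \<rho>')"
    by (metis surj_pair)
  have e: "(i, j, s) \<in> sectors k" "(i', j', s') \<in> sectors k"
    using x by (simp_all add: xy)
  then have s: "s \<in> {-1, 1}" "s' \<in> {-1, 1}"
    by (auto simp: sectors_def)
  have l: "\<rho> \<in> {0, 1}" "\<rho>' \<in> {0, 1}" "sector_label x = sector_label y"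
  proof -
    have "snd x \<in> {0, 1} \<and> snd y \<in> {0, 1} \<and> sector_label x = sector_label y"
      using False eq unfolding graph_point_eq_iff[OF x] by blast
    then show "\<rho> \<in> {0, 1}" "\<rho>' \<in> {0, 1}" "sector_label x = sector_label y"
      by (simp_all add: xy)
  qed
  then consider "\<rho> = 0" "\<rho>' = 0" "j = j'" | "\<rho> = 1" "\<rho>' = 1" "{i, j} = {i', j'}"
    by (auto simp: sector_label_def xy)
  then show ?thesis
  proof cases
    case 1
    have "rest_coord e 0 = 0" for e
      by (cases e) (simp add: rest_coord_def)
    with 1 show ?thesis
      using sector_point_base[of i j s k i' s' 0] e by (simp add: xy)
  next
    case 2
    have swap: "sector_point k ((i, j, s), 1, rest_coord (i, j, s) 1) =
        sector_point k ((j, i, \<sigma>), 1, rest_coord (j, i, \<sigma>) 1)"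
      if "i = j \<longrightarrow> \<sigma> = - s" for \<sigma>
      using that s by (intro sector_point_opposite e(1) rest_in_sector[OF e(1)])
        (auto simp: inner_coord_def rest_coord_def)
    have "i' = i \<and> j' = j \<or> i' = j \<and> j' = i" "s' = s \<or> s' = - s"
      using 2(3) s by (auto simp: doubleton_eq_iff)
    \<comment> \<open>For \<open>i \<noteq> j\<close> both points rest at midpoints, whatever the
      sign. For \<open>i = j\<close> they rest at the coordinates \<open>s / 2\<close> and
      \<open>- s / 2\<close>, so the opposite sign is the same pair with the roles
      exchanged.\<close>
    then consider "i' = i" "j' = j" "s' = s" | "i' = i" "j' = j" "i \<noteq> j"
      | "i' = j" "j' = i" "i = j \<longrightarrow> s' = - s"
      by blast
    then show ?thesis
    proof cases
      case 1
      with 2 show ?thesis by (simp add: xy)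
    next
      case 2
      with \<open>\<rho> = 1\<close> \<open>\<rho>' = 1\<close> show ?thesis
        by (simp add: xy sector_point_def rest_coord_def inner_coord_def)
    next
      case 3
      with \<open>\<rho> = 1\<close> \<open>\<rho>' = 1\<close> show ?thesis
        using swap[OF 3(3)] by (simp add: xy)
    qed
  qed
qed auto

text \<open>The slide keeps the ratio and ends at the rest position, which depends only on the point
  of the graph. Going from the graph to the rest positions and back is the identity, so the second
  homotopy is constant.\<close>

lemma unordered_conf2_bouquet_equiv_graph:
  "unordered_conf2 (bouquet k) homotopy_equivalent_space graph_space (sectors k) sector_label"
proof -
  let ?f = "\<lambda>(e, x). sector_graph_point k (e, fst x)"
  let ?g = "\<lambda>(e, \<rho>). sector_point k (e, \<rho>, rest_coord e \<rho>)"
  let ?H = "\<lambda>(t, (e, x)). sector_point k (e, slide e t x)"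
  let ?B = "unordered_conf2 (bouquet k)" and ?G = "graph_space (sectors k) sector_label"
  have top: "topspace (sector_space k) = Sigma (sectors k) sector"
    by (auto simp: sector_space_def)
  have sec: "fst x \<in> {0..1}" if "e \<in> sectors k" "x \<in> sector e" for e x
    using that by (cases e; cases x) (auto simp: sector_iff)
  show ?thesis
  proof (rule homotopy_equivalent_space_quotients[where f = ?f and g = ?g and H = ?H
        and K = "sector_graph_point k \<circ> snd", OF quotient_map_sector_point quotient_map_graph_point])
    show "continuous_map (sector_space k) ?G ?f"
      unfolding sector_space_def
    proof (rule continuous_map_from_sum_topology)
      fix e assume e: "e \<in> sectors k"
      have "continuous_map (top_of_set (sector e)) ?G (\<lambda>x. sector_graph_point k (e, fst x))"
        using sec[OF e] by (intro continuous_map_graph_point[OF e]) (auto intro!: continuous_intros)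
      then show "continuous_map (top_of_set (sector e)) ?G (\<lambda>x. ?f (e, x))"
        by simp
    qed
    have rest: "continuous_on A (rest_coord e)" for A e
      by (cases e; cases "fst e = fst (snd e)") (auto simp: rest_coord_def intro!: continuous_intros)
    show "continuous_map (edge_space (sectors k)) ?B ?g"
      unfolding edge_space_def
    proof (rule continuous_map_from_sum_topology)
      fix e assume e: "e \<in> sectors k"
      have "continuous_map (top_of_set {0..1}) (top_of_set (sector e)) (\<lambda>\<rho>. (\<rho>, rest_coord e \<rho>))"
        using rest_in_sector[OF e] by (intro continuous_map_into_subtopology)
          (auto intro!: continuous_intros rest)
      from continuous_map_compose[OF this continuous_map_sector_point[OF e]]
      show "continuous_map (top_of_set {0..1}) ?B (\<lambda>\<rho>. ?g (e, \<rho>))"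
        by (simp add: o_def)
    qed
    show "continuous_map (prod_topology (top_of_set {0..1}) (sector_space k)) ?B ?H"
      unfolding sector_space_def
    proof (rule continuous_map_prod_sum_topology)
      fix e assume e: "e \<in> sectors k"
      have "continuous_map (top_of_set ({0..1} \<times> sector e)) (top_of_set (sector e)) (\<lambda>(t, x). slide e t x)"
      proof (rule continuous_map_into_subtopology)
        have "continuous_on ({0..1} \<times> sector e) (\<lambda>y. rest_coord e (fst (snd y)))"
          by (rule continuous_on_compose2[OF rest[of UNIV]]) (auto intro!: continuous_intros)
        then show "continuous_map (top_of_set ({0..1} \<times> sector e)) euclidean (\<lambda>(t, x). slide e t x)"
          by (auto simp: slide_def case_prod_unfold intro!: continuous_intros)
      qed (use slide_in_sector[OF e] in auto)
      from continuous_map_compose[OF this continuous_map_sector_point[OF e]]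
      show "continuous_map (prod_topology (top_of_set {0..1}) (top_of_set (sector e))) ?B (\<lambda>(t, x). ?H (t, (e, x)))"
        by (simp add: prod_top_of_set o_def case_prod_unfold)
    qed
    show "continuous_map (prod_topology (top_of_set {0..1}) (edge_space (sectors k))) ?G (sector_graph_point k \<circ> snd)"
      by (rule continuous_map_compose[OF continuous_map_snd quotient_imp_continuous_map[OF quotient_map_graph_point]])
    show f_compat: "?f x = ?f y" if "x \<in> topspace (sector_space k)" "y \<in> topspace (sector_space k)"
      "sector_point k x = sector_point k y" for x y
      using sector_graph_point_compat[of "fst x" "fst (snd x)" "snd (snd x)" k "fst y" "fst (snd y)" "snd (snd y)"] that
      by (simp add: case_prod_unfold)
    show g_compat: "?g x = ?g y" if "x \<in> topspace (edge_space (sectors k))" "y \<in> topspace (edge_space (sectors k))"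
      "sector_graph_point k x = sector_graph_point k y" for x y
      using sector_point_rest_compat[of x k y] that by (simp add: case_prod_unfold)
    show "?H (t, x) = ?H (t, y)" if "t \<in> {0..1}" "x \<in> topspace (sector_space k)" "y \<in> topspace (sector_space k)"
      "sector_point k x = sector_point k y" for t x y
      using sector_point_slide_compat[of "fst x" "fst (snd x)" "snd (snd x)" k "fst y" "fst (snd y)" "snd (snd y)" t] that
      by (simp add: case_prod_unfold)
    show "?H (0, x) = sector_point k x" for x
      by (simp add: slide_def case_prod_unfold)
    show "?H (1, x) = ?g y"
      if x: "x \<in> topspace (sector_space k)" and y: "y \<in> topspace (edge_space (sectors k))"
        and eq: "?f x = sector_graph_point k y" for x y
    proof -
      obtain e \<rho> v where x': "x = (e, \<rho>, v)"
        by (metis surj_pair)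
      have "e \<in> sectors k" "\<rho> \<in> {0..1}"
        using x sec[of e "(\<rho>, v)"] by (simp_all add: top x')
      then have "?g (e, \<rho>) = ?g y"
        using eq y by (intro g_compat) (simp_all add: x')
      then show ?thesis
        by (simp add: x' slide_1)
    qed
    show "(sector_graph_point k \<circ> snd) (1, y) = ?f x"
      if x: "x \<in> topspace (sector_space k)" and y: "y \<in> topspace (edge_space (sectors k))"
        and eq: "?g y = sector_point k x" for x y
    proof -
      obtain e \<rho> where y': "y = (e, \<rho>)" "e \<in> sectors k" "\<rho> \<in> {0..1}"
        using y unfolding topspace_edge_space by (rule SigmaE)
      then have "(e, \<rho>, rest_coord e \<rho>) \<in> topspace (sector_space k)"
        by (simp add: top rest_in_sector)
      then have "?f (e, \<rho>, rest_coord e \<rho>) = ?f x"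
        using x eq by (intro f_compat) (simp_all add: y')
      then show ?thesis
        by (simp add: y')
    qed
  qed simp_all
qed

section \<open>Counting and connectedness of the sector graph\<close>

text \<open>The sets \<open>{i, j}\<close> are split by size, according to whether the circles
  coincide, so that binomial coefficients count them.\<close>

lemma vertices_sectors:
  "vertices (sectors k) sector_label =
     Inl ` {..<k} \<union> Inr ` ({A. A \<subseteq> {..<k} \<and> card A = 1} \<union> {A. A \<subseteq> {..<k} \<and> card A = 2})"
proof (intro equalityI subsetI)
  fix v assume "v \<in> vertices (sectors k) sector_label"
  then obtain i j s where "(i, j, s) \<in> sectors k" "v = Inl j \<or> v = Inr {i, j}"
    unfolding vertices_iff by (auto simp: sector_label_def)
  then show "v \<in> Inl ` {..<k} \<union> Inr ` ({A. A \<subseteq> {..<k} \<and> card A = 1} \<union> {A. A \<subseteq> {..<k} \<and> card A = 2})"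
    by (cases "i = j") (auto simp: sectors_def)
next
  fix v assume "v \<in> Inl ` {..<k} \<union> Inr ` ({A. A \<subseteq> {..<k} \<and> card A = 1} \<union> {A. A \<subseteq> {..<k} \<and> card A = 2})"
  then consider j where "v = Inl j" "j < k" | A where "v = Inr A" "A \<subseteq> {..<k}" "card A = 1 \<or> card A = 2"
    by blast
  then obtain i j where "i < k" "j < k" "v = Inl j \<or> v = Inr {i, j}"
  proof cases
    case 2
    then obtain i j where "A = {i, j}"
      by (metis card_1_singletonE card_2_iff insert_absorb2)
    with 2 that show thesis by auto
  qed (use that in blast)
  then have "(i, j, 1) \<in> sectors k" "v = sector_label ((i, j, 1), 0) \<or> v = sector_label ((i, j, 1), 1)"
    by (auto simp: sectors_def sector_label_def)
  then show "v \<in> vertices (sectors k) sector_label"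
    unfolding vertices_iff by blast
qed

lemma card_vertices_sectors: "card (vertices (sectors k) sector_label) = 2 * k + k * (k - 1) div 2"
proof -
  have "card ({A. A \<subseteq> {..<k} \<and> card A = 1} \<union> {A. A \<subseteq> {..<k} \<and> card A = 2}) = k + k * (k - 1) div 2"
    by (subst card_Un_disjoint) (auto simp: n_subsets choose_two)
  moreover have "card (Inl ` {..<k} :: (nat + nat set) set) = k"
    by (simp add: card_image)
  ultimately show ?thesis
    unfolding vertices_sectors by (subst card_Un_disjoint) (auto simp: card_image)
qed

text \<open>Sectors with the two circles in either order share their end at ratio 1, so
  \<open>Inl j\<close> is joined to \<open>Inl 0\<close> through \<open>Inr {0, j}\<close>.\<close>

lemma connected_sectors: "connected_graph (sectors k) sector_label"
  unfolding connected_graph_def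
proof (intro allI impI)
  fix S assume "\<forall>e\<in>sectors k. sector_label (e, 0) \<in> S \<longleftrightarrow> sector_label (e, 1) \<in> S"
  then have *: "Inl j \<in> S \<longleftrightarrow> Inr {i, j} \<in> S" if "i < k" "j < k" for i j
    using that by (auto simp: sectors_def sector_label_def)
  have "v \<in> S \<longleftrightarrow> Inl 0 \<in> S" if v: "v \<in> vertices (sectors k) sector_label" for v
  proof -
    obtain i j s where "(i, j, s) \<in> sectors k" and v: "v = Inl j \<or> v = Inr {i, j}"
      using v unfolding vertices_iff by (auto simp: sector_label_def)
    then have ij: "i < k" "j < k" "0 < k"
      by (auto simp: sectors_def)
    have "Inl j \<in> S \<longleftrightarrow> Inl 0 \<in> S"
      using *[of 0 j] *[of j 0] ij by (simp add: insert_commute)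
    with v *[of i j] ij show ?thesis by auto
  qed
  then show "vertices (sectors k) sector_label \<subseteq> S \<or> vertices (sectors k) sector_label \<inter> S = {}"
    by blast
qed

theorem proposition3p4:
  fixes k :: nat
  assumes "k \<ge> 1"
  shows "unordered_conf2 (bouquet k) homotopy_equivalent_space bouquet (3 * k * (k - 1) div 2 + 1)"
proof -
  obtain m where m: "k = Suc m"
    using assms by (cases k) auto
  \<comment> \<open>A product of consecutive numbers is even; with \<open>c\<close> as its half
    there are \<open>4 * c + 2 * k\<close> edges and \<open>2 * k + c\<close> vertices, leaving
    \<open>3 * c + 1\<close> circles.\<close>
  obtain c where c: "k * (k - 1) = 2 * c"
    using m by (metis dvdE even_mult_iff even_Suc diff_Suc_1)
  have E: "card (sectors k) = 2 * (2 * c) + 2 * k"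
    using c by (simp add: sectors_def card_cartesian_product m algebra_simps)
  have V: "card (vertices (sectors k) sector_label) = 2 * k + c"
    using c by (simp add: card_vertices_sectors)
  have "graph_space (sectors k) sector_label homotopy_equivalent_space
      bouquet (card (sectors k) + 1 - card (vertices (sectors k) sector_label))"
  proof (rule connected_graph_homotopy_equivalent_bouquet[OF finite_sectors _ connected_sectors])
    show "sectors k \<noteq> {}"
      using m by (auto simp: sectors_def)
    show "card (vertices (sectors k) sector_label) \<le> card (sectors k)"
      by (simp add: E V)
  qed
  moreover have "3 * k * (k - 1) div 2 + 1 = card (sectors k) + 1 - card (vertices (sectors k) sector_label)"
    using c by (simp add: E V mult.assoc)
  ultimately show ?thesis
    using homotopy_eqv_trans[OF unordered_conf2_bouquet_equiv_graph] by simp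
qed

end
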